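(* Let $G$ be an $m\times n$ grid in which one side length is even and the other is odd. Every non-partitive initial configuration of $k\ge3$ robots on distinct nodes of $G$ is gatherable despite at most one crash fault.
   Context: Model. The grid is the anonymous grid graph. A configuration is a map $f:V(G)\to\{0,1,2\}$ ($0$ empty, $1$ singleton, $2$ multiplicity = at least two robots). Initially robots occupy distinct nodes. Robots are anonymous, identical, oblivious, cannot communicate, share no coordinate system, orientation or chirality, and run the same deterministic algorithm. Each robot repeatedly performs Look–Compute–Move cycles: it takes a snapshot of the whole configuration (global visibility, weak multiplicity detection: it learns $f$ up to grid symmetries), decides to stay or move to an adjacent node, and moves instantaneously. Fully asynchronous: every non-crashed robot is activated infinitely often, durations are finite, unbounded and adversarial, so moves may be based on outdated snapshots. At most one robot may crash at an adversarial time: it stops forever, stays visible and is indistinguishable. A configuration is gatherable despite at most one crash fault if some such algorithm guarantees, in every execution with at most one crash, that after finite time all non-crashed robots are on one node and remain there. Partitive: an automorphism of $(G,f)$ is a graph automorphism $\varphi$ with $f\circ\varphi=f$; the configuration is partitive if some automorphism $\varphi$ of order $p>1$ has all orbits of $V(G)$ under $\langle\varphi\rangle$ of size exactly $p$. *)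

theory Defs
  imports Main
begin

type_synonym node = "nat \<times> nat"
type_synonym config = "node \<Rightarrow> nat"   (* 0 empty, 1 singleton, 2 multiplicity *)

definition grid_V :: "nat \<Rightarrow> nat \<Rightarrow> node set" where
  "grid_V m n = {0..<m} \<times> {0..<n}"

definition grid_adj :: "node \<Rightarrow> node \<Rightarrow> bool" where
  "grid_adj u v \<longleftrightarrow>
     (fst u = fst v \<and> (snd u = Suc (snd v) \<or> snd v = Suc (snd u))) \<or>
     (snd u = snd v \<and> (fst u = Suc (fst v) \<or> fst v = Suc (fst u)))"

definition grid_aut :: "nat \<Rightarrow> nat \<Rightarrow> (node \<Rightarrow> node) \<Rightarrow> bool" where
  "grid_aut m n \<phi> \<longleftrightarrow> bij_betw \<phi> (grid_V m n) (grid_V m n) \<and>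
     (\<forall>u\<in>grid_V m n. \<forall>v\<in>grid_V m n. grid_adj u v \<longleftrightarrow> grid_adj (\<phi> u) (\<phi> v))"

definition orbit :: "(node \<Rightarrow> node) \<Rightarrow> node \<Rightarrow> node set" where
  "orbit \<phi> x = range (\<lambda>i. (\<phi> ^^ i) x)"

definition partitive :: "nat \<Rightarrow> nat \<Rightarrow> config \<Rightarrow> bool" where
  "partitive m n f \<longleftrightarrow> (\<exists>\<phi> p. grid_aut m n \<phi> \<and> (\<forall>x\<in>grid_V m n. f (\<phi> x) = f x) \<and>
     p > 1 \<and> (\<forall>x\<in>grid_V m n. (\<phi> ^^ p) x = x) \<and>
     (\<forall>q. 0 < q \<and> q < p \<longrightarrow> (\<exists>x\<in>grid_V m n. (\<phi> ^^ q) x \<noteq> x)) \<and>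
     (\<forall>x\<in>grid_V m n. card (orbit \<phi> x) = p))"

text \<open>Configuration (with weak multiplicity detection) of robots 0..k-1 at positions pos.\<close>
definition config_of :: "nat \<Rightarrow> (nat \<Rightarrow> node) \<Rightarrow> config" where
  "config_of k pos x = min 2 (card {r. r < k \<and> pos r = x})"

text \<open>An algorithm maps a snapshot (in the robot's local frame) and the robot's own
  (local) position to the destination: stay or an adjacent node.\<close>
definition valid_algo :: "nat \<Rightarrow> nat \<Rightarrow> (config \<Rightarrow> node \<Rightarrow> node) \<Rightarrow> bool" where
  "valid_algo m n A \<longleftrightarrow> (\<forall>g. \<forall>u\<in>grid_V m n. A g u \<in> grid_V m n \<and> (A g u = u \<or> grid_adj u (A g u)))"

text \<open>Look+Compute of a robot at v: the adversary chooses the local frame tau (a grid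
  automorphism), so the robot sees the configuration only up to grid symmetries.\<close>
definition look_result :: "nat \<Rightarrow> nat \<Rightarrow> nat \<Rightarrow> (config \<Rightarrow> node \<Rightarrow> node) \<Rightarrow> (nat \<Rightarrow> node)
    \<Rightarrow> node \<Rightarrow> node \<Rightarrow> bool" where
  "look_result m n k A pos v d \<longleftrightarrow> (\<exists>\<tau> u. grid_aut m n \<tau> \<and> u \<in> grid_V m n \<and> \<tau> u = v \<and>
     d = \<tau> (A (\<lambda>x. if x \<in> grid_V m n then config_of k pos (\<tau> x) else 0) u))"

text \<open>Asynchronous execution: at step i robot sched i is activated; if it has no pending
  move it performs Look+Compute (storing the computed destination), otherwise it
  performs its pending (instantaneous) Move. P i = positions, D i = pending moves.\<close>
definition execution :: "nat \<Rightarrow> nat \<Rightarrow> nat \<Rightarrow> (config \<Rightarrow> node \<Rightarrow> node) \<Rightarrow> (nat \<Rightarrow> node)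
    \<Rightarrow> (nat \<Rightarrow> nat) \<Rightarrow> (nat \<Rightarrow> nat \<Rightarrow> node) \<Rightarrow> (nat \<Rightarrow> nat \<Rightarrow> node option) \<Rightarrow> bool" where
  "execution m n k A pos0 sched P D \<longleftrightarrow> P 0 = pos0 \<and> D 0 = (\<lambda>r. None) \<and>
     (\<forall>i. case D i (sched i) of
        None \<Rightarrow> P (Suc i) = P i \<and>
               (\<exists>d. D (Suc i) = (D i)(sched i := Some d) \<and> look_result m n k A (P i) (P i (sched i)) d)
      | Some w \<Rightarrow> P (Suc i) = (P i)(sched i := w) \<and> D (Suc i) = (D i)(sched i := None))"

definition admissible :: "nat \<Rightarrow> (nat \<Rightarrow> nat) \<Rightarrow> nat option \<Rightarrow> bool" where
  "admissible k sched crash \<longleftrightarrow> (\<forall>i. sched i < k) \<and>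
     (\<forall>r<k. crash \<noteq> Some r \<longrightarrow> (\<forall>t. \<exists>i\<ge>t. sched i = r)) \<and>
     (case crash of None \<Rightarrow> True | Some c \<Rightarrow> c < k \<and> (\<exists>t. \<forall>i\<ge>t. sched i \<noteq> c))"

definition gathered :: "nat \<Rightarrow> nat option \<Rightarrow> (nat \<Rightarrow> nat \<Rightarrow> node) \<Rightarrow> bool" where
  "gathered k crash P \<longleftrightarrow> (\<exists>T. \<forall>i\<ge>T. \<forall>r<k. \<forall>r'<k.
     crash \<noteq> Some r \<longrightarrow> crash \<noteq> Some r' \<longrightarrow> P i r = P i r')"

definition gatherable_1crash :: "nat \<Rightarrow> nat \<Rightarrow> nat \<Rightarrow> (nat \<Rightarrow> node) \<Rightarrow> bool" where
  "gatherable_1crash m n k pos0 \<longleftrightarrow> (\<exists>A. valid_algo m n A \<and>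
     (\<forall>sched crash P D. admissible k sched crash \<and> execution m n k A pos0 sched P D
        \<longrightarrow> gathered k crash P))"

end

(* Write goal = (0, c) and antigoal = (m - 1, c) for the two ends of the central axis of an
   m x n grid with m even and n = 2 c + 1. A non-partitive configuration distinguishes the two
   ends: either their multiplicities differ, or, reading the configuration as a number with
   position-dependent binary weights from each of the four corner frames, the larger reading
   from one end beats the larger reading from the other. Robots move to the selected end,
   first along x and then along row 0. Every such move increases the readings from the
   selected end by more than the opposite ones, so the orientation survives arbitrary
   asynchrony as long as the observed configuration shows exact robot counts. As soon as the
   goal shows more robots than the antigoal all robots may move, since nobody leaves the goal
   or enters the antigoal. During a tie only the robot at the antigoal and the robots with at
   most one robot closer to the goal move: at least two robots move, so a crash does not block
   them, and no three of them meet outside the goal. The sum of the ranks of the robots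
   decreases with every move. *)
theory Submission
  imports Defs "HOL-Library.Nat_Bijection"
begin

section \<open>Automorphisms of grids\<close>

text \<open>Manhattan distance, which is the graph distance of the grid; taken in \<open>int\<close>
  so that differences are not truncated.\<close>

definition grid_dist :: "node \<Rightarrow> node \<Rightarrow> int" where
  "grid_dist u v = \<bar>int (fst u) - int (fst v)\<bar> + \<bar>int (snd u) - int (snd v)\<bar>"

definition flip_x :: "nat \<Rightarrow> node \<Rightarrow> node" where
  "flip_x m v = (m - 1 - fst v, snd v)"

definition flip_y :: "nat \<Rightarrow> node \<Rightarrow> node" where
  "flip_y n v = (fst v, n - 1 - snd v)"

lemma mem_grid_V [simp]: "v \<in> grid_V m n \<longleftrightarrow> fst v < m \<and> snd v < n"
  by (cases v) (auto simp: grid_V_def)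

lemma finite_grid_V [simp]: "finite (grid_V m n)"
  by (simp add: grid_V_def)

lemma grid_adj_iff_dist: "grid_adj u v \<longleftrightarrow> grid_dist u v = 1"
  unfolding grid_adj_def grid_dist_def by linarith

lemma grid_dist_triangle: "grid_dist u w \<le> grid_dist u v + grid_dist v w"
  unfolding grid_dist_def by linarith

text \<open>Moving one coordinate of \<open>v\<close> towards \<open>u\<close> stays inside the
  rectangle, which allows induction along shortest paths.\<close>

lemma grid_dist_step:
  assumes "u \<in> grid_V m n" "v \<in> grid_V m n" "grid_dist u v = int (Suc d)"
  shows "\<exists>w\<in>grid_V m n. grid_dist u w = int d \<and> grid_adj w v"
proof -
  obtain a b x y where uv: "u = (a, b)" "v = (x, y)" by fastforce
  have "a < x \<or> x < a \<or> a = x \<and> b < y \<or> a = x \<and> y < b"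
    using assms(3) by (auto simp: uv grid_dist_def)
  then show ?thesis
  proof (elim disjE)
    assume "a < x"
    then show ?thesis using assms
      by (intro bexI[of _ "(x - 1, y)"]) (auto simp: uv grid_dist_def grid_adj_def)
  next
    assume "x < a"
    then show ?thesis using assms
      by (intro bexI[of _ "(x + 1, y)"]) (auto simp: uv grid_dist_def grid_adj_def)
  next
    assume "a = x \<and> b < y"
    then show ?thesis using assms
      by (intro bexI[of _ "(x, y - 1)"]) (auto simp: uv grid_dist_def grid_adj_def)
  next
    assume "a = x \<and> y < b"
    then show ?thesis using assms
      by (intro bexI[of _ "(x, y + 1)"]) (auto simp: uv grid_dist_def grid_adj_def)
  qed
qed

text \<open>The image of a shortest path is a path. Only adjacency in one direction is assumed, so
  the bound applies to an automorphism and to its inverse alike.\<close>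

lemma grid_dist_le:
  assumes adj: "\<And>u v. u \<in> grid_V m n \<Longrightarrow> v \<in> grid_V m n \<Longrightarrow> grid_adj u v \<Longrightarrow> grid_adj (\<phi> u) (\<phi> v)"
    and "u \<in> grid_V m n" "v \<in> grid_V m n" "grid_dist u v = int d"
  shows "grid_dist (\<phi> u) (\<phi> v) \<le> int d"
  using assms(3,4)
proof (induction d arbitrary: v)
  case 0
  then have "u = v" by (auto simp: grid_dist_def prod_eq_iff)
  then show ?case by (simp add: grid_dist_def)
next
  case (Suc d)
  obtain w where w: "w \<in> grid_V m n" "grid_dist u w = int d" "grid_adj w v"
    using grid_dist_step[OF assms(2) Suc.prems] by blast
  have "grid_dist (\<phi> w) (\<phi> v) = 1"
    using adj[OF w(1) Suc.prems(1) w(3)] by (simp add: grid_adj_iff_dist)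
  then show ?case
    using Suc.IH[OF w(1,2)] grid_dist_triangle[of "\<phi> u" "\<phi> v" "\<phi> w"] by simp
qed

lemma grid_aut_dist:
  assumes aut: "grid_aut m n \<phi>" and u: "u \<in> grid_V m n" and v: "v \<in> grid_V m n"
  shows "grid_dist (\<phi> u) (\<phi> v) = grid_dist u v"
proof -
  let ?V = "grid_V m n" and ?\<psi> = "inv_into (grid_V m n) \<phi>"
  have nn: "0 \<le> grid_dist x y" for x y by (simp add: grid_dist_def)
  have bij: "bij_betw \<phi> ?V ?V"
    and adj: "\<And>u v. u \<in> ?V \<Longrightarrow> v \<in> ?V \<Longrightarrow> grid_adj u v \<longleftrightarrow> grid_adj (\<phi> u) (\<phi> v)"
    using aut unfolding grid_aut_def by blast+
  have inv1: "?\<psi> w \<in> ?V" "\<phi> (?\<psi> w) = w" if "w \<in> ?V" for w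
    using bij that by (metis bij_betw_def inv_into_into, metis bij_betw_def f_inv_into_f)
  have inv2: "?\<psi> (\<phi> w) = w" "\<phi> w \<in> ?V" if "w \<in> ?V" for w
    using bij that by (metis bij_betw_def inv_into_f_f, metis bij_betwE)
  have "grid_dist (\<phi> u) (\<phi> v) \<le> grid_dist u v"
    using grid_dist_le[of m n \<phi> u v "nat (grid_dist u v)"] adj u v nn by simp
  moreover have "grid_dist (?\<psi> (\<phi> u)) (?\<psi> (\<phi> v)) \<le> grid_dist (\<phi> u) (\<phi> v)"
    using grid_dist_le[of m n ?\<psi> "\<phi> u" "\<phi> v" "nat (grid_dist (\<phi> u) (\<phi> v))"] adj inv1 inv2 u v nn
    by (metis int_nat_eq)
  ultimately show ?thesis using inv2 u v by simp
qed

text \<open>Diametrically opposite corners stay opposite, and the distances to two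
  corners on a side of length m determine a node.\<close>
lemma grid_aut_cases:
  assumes aut: "grid_aut m n \<phi>" and "m \<noteq> n" and "0 < m" "0 < n"
  obtains (aut_id) "\<forall>v\<in>grid_V m n. \<phi> v = v" | (aut_flip_x) "\<forall>v\<in>grid_V m n. \<phi> v = flip_x m v"
    | (aut_flip_y) "\<forall>v\<in>grid_V m n. \<phi> v = flip_y n v" | (aut_flip_xy) "\<forall>v\<in>grid_V m n. \<phi> v = flip_x m (flip_y n v)"
proof -
  let ?V = "grid_V m n"
  have mem: "\<phi> v \<in> ?V" if "v \<in> ?V" for v
    using aut that unfolding grid_aut_def by (metis bij_betwE)
  obtain a1 a2 where a: "\<phi> (0,0) = (a1,a2)" by fastforce
  obtain b1 b2 where b: "\<phi> (m-1,0) = (b1,b2)" by fastforce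
  obtain c1 c2 where c: "\<phi> (0,n-1) = (c1,c2)" by fastforce
  obtain d1 d2 where d: "\<phi> (m-1,n-1) = (d1,d2)" by fastforce
  note corner = mem[of "(0,0)"] mem[of "(m-1,0)"] mem[of "(0,n-1)"] mem[of "(m-1,n-1)"]
  have bounds: "a1 < m" "b1 < m" "c1 < m" "d1 < m" "a2 < n" "b2 < n" "c2 < n" "d2 < n"
    using corner assms a b c d by auto
  have ad: "\<bar>int a1 - int d1\<bar> + \<bar>int a2 - int d2\<bar> = int m + int n - 2"
    using grid_aut_dist[OF aut, of "(0,0)" "(m-1,n-1)"] assms a d by (simp add: grid_dist_def of_nat_diff)
  have bc: "\<bar>int b1 - int c1\<bar> + \<bar>int b2 - int c2\<bar> = int m + int n - 2"
    using grid_aut_dist[OF aut, of "(m-1,0)" "(0,n-1)"] assms b c by (simp add: grid_dist_def of_nat_diff)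
  have ab: "\<bar>int a1 - int b1\<bar> + \<bar>int a2 - int b2\<bar> = int m - 1"
    using grid_aut_dist[OF aut, of "(0,0)" "(m-1,0)"] assms a b by (simp add: grid_dist_def of_nat_diff)
  have a_corner: "a1 = 0 \<or> a1 = m - 1" "a2 = 0 \<or> a2 = n - 1" using ad bounds by linarith+
  have b_corner: "b1 = 0 \<or> b1 = m - 1" "b2 = 0 \<or> b2 = n - 1" using bc bounds by linarith+
  \<comment> \<open>Because \<open>m \<noteq> n\<close>, the corner at distance \<open>m - 1\<close>
    lies along x and not along y; this excludes the quarter turns and diagonal reflections of a
    square.\<close>
  have b_eq: "b1 = m - 1 - a1 \<and> b2 = a2"
    using a_corner b_corner ab \<open>m \<noteq> n\<close> \<open>0 < m\<close> \<open>0 < n\<close> by (elim disjE) auto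
  have eqs: "\<bar>int a1 - int p\<bar> + \<bar>int a2 - int q\<bar> = int x + int y \<and>
      \<bar>int b1 - int p\<bar> + \<bar>int a2 - int q\<bar> = int m - 1 - int x + int y \<and> p < m \<and> q < n"
    if "x < m" "y < n" "\<phi> (x,y) = (p,q)" for x y p q
    using grid_aut_dist[OF aut, of "(0,0)" "(x,y)"] grid_aut_dist[OF aut, of "(m-1,0)" "(x,y)"]
      mem[of "(x,y)"] that assms a b b_eq by (auto simp: grid_dist_def of_nat_diff)
  consider "a1 = 0" "a2 = 0" | "a1 = m - 1" "a2 = 0" | "a1 = 0" "a2 = n - 1" | "a1 = m - 1" "a2 = n - 1"
    using a_corner by blast
  then show ?thesis
  proof cases
    case 1
    have "\<phi> (x,y) = (x,y)" if "x < m" "y < n" for x y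
    proof -
      obtain p q where pq: "\<phi> (x,y) = (p,q)" by fastforce
      note e = eqs[OF that pq]
      have "\<bar>int a1 - int p\<bar> = int p" "\<bar>int b1 - int p\<bar> = int m - 1 - int p" "\<bar>int a2 - int q\<bar> = int q"
        using e 1 b_eq assms(3,4) by (simp_all add: of_nat_diff)
      then have "int p = int (x)" "int q = int (y)" using e that by (simp_all add: of_nat_diff)
      then have "p = x" "q = y" by simp_all
      then show ?thesis using pq by simp
    qed
    note xy = this
    have "\<forall>v\<in>?V. \<phi> v = v"
    proof
      fix v assume "v \<in> ?V"
      then show "\<phi> v = v" using xy[of "fst v" "snd v"] unfolding mem_grid_V prod.collapse by blast
    qed
    then show ?thesis by (rule aut_id)
  next
    case 2
    have "\<phi> (x,y) = flip_x m (x,y)" if "x < m" "y < n" for x y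
    proof -
      obtain p q where pq: "\<phi> (x,y) = (p,q)" by fastforce
      note e = eqs[OF that pq]
      have "\<bar>int a1 - int p\<bar> = int m - 1 - int p" "\<bar>int b1 - int p\<bar> = int p" "\<bar>int a2 - int q\<bar> = int q"
        using e 2 b_eq assms(3,4) by (simp_all add: of_nat_diff)
      then have "int p = int (m - 1 - x)" "int q = int (y)" using e that by (simp_all add: of_nat_diff)
      then have "p = m - 1 - x" "q = y" by simp_all
      then show ?thesis using pq by (simp add: flip_x_def)
    qed
    note xy = this
    have "\<forall>v\<in>?V. \<phi> v = flip_x m v"
    proof
      fix v assume "v \<in> ?V"
      then show "\<phi> v = flip_x m v" using xy[of "fst v" "snd v"] unfolding mem_grid_V prod.collapse by blast
    qed
    then show ?thesis by (rule aut_flip_x)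
  next
    case 3
    have "\<phi> (x,y) = flip_y n (x,y)" if "x < m" "y < n" for x y
    proof -
      obtain p q where pq: "\<phi> (x,y) = (p,q)" by fastforce
      note e = eqs[OF that pq]
      have "\<bar>int a1 - int p\<bar> = int p" "\<bar>int b1 - int p\<bar> = int m - 1 - int p" "\<bar>int a2 - int q\<bar> = int n - 1 - int q"
        using e 3 b_eq assms(3,4) by (simp_all add: of_nat_diff)
      then have "int p = int (x)" "int q = int (n - 1 - y)" using e that by (simp_all add: of_nat_diff)
      then have "p = x" "q = n - 1 - y" by simp_all
      then show ?thesis using pq by (simp add: flip_y_def)
    qed
    note xy = this
    have "\<forall>v\<in>?V. \<phi> v = flip_y n v"
    proof
      fix v assume "v \<in> ?V"
      then show "\<phi> v = flip_y n v" using xy[of "fst v" "snd v"] unfolding mem_grid_V prod.collapse by blast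
    qed
    then show ?thesis by (rule aut_flip_y)
  next
    case 4
    have "\<phi> (x,y) = flip_x m (flip_y n (x,y))" if "x < m" "y < n" for x y
    proof -
      obtain p q where pq: "\<phi> (x,y) = (p,q)" by fastforce
      note e = eqs[OF that pq]
      have "\<bar>int a1 - int p\<bar> = int m - 1 - int p" "\<bar>int b1 - int p\<bar> = int p" "\<bar>int a2 - int q\<bar> = int n - 1 - int q"
        using e 4 b_eq assms(3,4) by (simp_all add: of_nat_diff)
      then have "int p = int (m - 1 - x)" "int q = int (n - 1 - y)" using e that by (simp_all add: of_nat_diff)
      then have "p = m - 1 - x" "q = n - 1 - y" by simp_all
      then show ?thesis using pq by (simp add: flip_x_def flip_y_def)
    qed
    note xy = this
    have "\<forall>v\<in>?V. \<phi> v = flip_x m (flip_y n v)"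
    proof
      fix v assume "v \<in> ?V"
      then show "\<phi> v = flip_x m (flip_y n v)" using xy[of "fst v" "snd v"] unfolding mem_grid_V prod.collapse by blast
    qed
    then show ?thesis by (rule aut_flip_xy)
  qed
qed

section \<open>Reflections and fixed-point-free involutions\<close>

lemma grid_autI:
  assumes "\<And>v. v \<in> grid_V m n \<Longrightarrow> \<phi> v \<in> grid_V m n"
    and "\<And>v. v \<in> grid_V m n \<Longrightarrow> \<phi> (\<phi> v) = v"
    and "\<And>u v. u \<in> grid_V m n \<Longrightarrow> v \<in> grid_V m n \<Longrightarrow> grid_dist (\<phi> u) (\<phi> v) = grid_dist u v"
  shows "grid_aut m n \<phi>"
  unfolding grid_aut_def grid_adj_iff_dist
  using assms by (auto intro!: bij_betw_byWitness[where f' = \<phi>])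

lemma grid_dist_flip_x:
  "u \<in> grid_V m n \<Longrightarrow> v \<in> grid_V m n \<Longrightarrow> grid_dist (flip_x m u) (flip_x m v) = grid_dist u v"
  by (auto simp: grid_dist_def flip_x_def of_nat_diff)

lemma grid_dist_flip_y:
  "u \<in> grid_V m n \<Longrightarrow> v \<in> grid_V m n \<Longrightarrow> grid_dist (flip_y n u) (flip_y n v) = grid_dist u v"
  by (auto simp: grid_dist_def flip_y_def of_nat_diff)

lemma grid_aut_flip_x: "grid_aut m n (flip_x m)"
  by (rule grid_autI) (simp_all add: grid_dist_flip_x del: mem_grid_V, auto simp: flip_x_def)

lemma grid_aut_flip_y: "grid_aut m n (flip_y n)"
  by (rule grid_autI) (simp_all add: grid_dist_flip_y del: mem_grid_V, auto simp: flip_y_def)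

lemma grid_aut_flip_xy: "grid_aut m n (\<lambda>v. flip_x m (flip_y n v))"
proof (rule grid_autI)
  fix u v assume uv: "u \<in> grid_V m n" "v \<in> grid_V m n"
  then have "flip_y n u \<in> grid_V m n" "flip_y n v \<in> grid_V m n" by (auto simp: flip_y_def)
  then show "grid_dist (flip_x m (flip_y n u)) (flip_x m (flip_y n v)) = grid_dist u v"
    using grid_dist_flip_x grid_dist_flip_y uv by metis
qed (auto simp: flip_x_def flip_y_def)

text \<open>All orbits of a fixed-point-free involution have two elements. The node
  \<open>v0\<close> makes the grid nonempty, so that the order is exactly 2 and not 1.\<close>

lemma partitive_if_free_involution:
  assumes aut: "grid_aut m n \<phi>"
    and invol: "\<And>v. v \<in> grid_V m n \<Longrightarrow> \<phi> (\<phi> v) = v"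
    and free: "\<And>v. v \<in> grid_V m n \<Longrightarrow> \<phi> v \<noteq> v"
    and inv: "\<And>v. v \<in> grid_V m n \<Longrightarrow> f (\<phi> v) = f v"
    and ne: "v0 \<in> grid_V m n"
  shows "partitive m n f"
  unfolding partitive_def
proof (intro exI[of _ \<phi>] exI[of _ 2] conjI ballI allI impI)
  fix x assume x: "x \<in> grid_V m n"
  show "f (\<phi> x) = f x" "(\<phi> ^^ 2) x = x"
    using inv invol x by (simp_all add: numeral_2_eq_2)
  have "(\<phi> ^^ i) x \<in> {x, \<phi> x}" for i
    by (induction i) (use invol[OF x] in auto)
  moreover have "x = (\<phi> ^^ 0) x" "\<phi> x = (\<phi> ^^ 1) x" by simp_all
  ultimately have "orbit \<phi> x = {x, \<phi> x}"
    unfolding orbit_def by blast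
  then show "card (orbit \<phi> x) = 2" using free[OF x] by (simp add: card_insert_if)
next
  fix q :: nat assume "0 < q \<and> q < 2"
  then have "q = 1" by linarith
  then show "\<exists>x\<in>grid_V m n. (\<phi> ^^ q) x \<noteq> x" using ne free by auto
qed (use aut in auto)

section \<open>Transfer along grid isomorphisms\<close>

text \<open>Robots on one grid simulate \<open>A'\<close> through \<open>\<psi>\<close>, and
  \<open>\<psi>\<close> carries executions over with the same schedule and crash. This serves to
  exchange the coordinates and to reflect the grid so that the selected end becomes the
  goal.\<close>

lemma gatherable_1crash_iso:
  assumes gath: "gatherable_1crash m' n' k (\<psi> \<circ> pos0)"
    and pos0: "pos0 ` {..<k} \<subseteq> grid_V m n"
    and psi: "\<And>v. v \<in> grid_V m n \<Longrightarrow> \<psi> v \<in> grid_V m' n'"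
    and psi': "\<And>v. v \<in> grid_V m' n' \<Longrightarrow> \<psi>' v \<in> grid_V m n"
    and inv: "\<And>v. v \<in> grid_V m n \<Longrightarrow> \<psi>' (\<psi> v) = v"
    and inv': "\<And>v. v \<in> grid_V m' n' \<Longrightarrow> \<psi> (\<psi>' v) = v"
    and adj: "\<And>u v. u \<in> grid_V m n \<Longrightarrow> v \<in> grid_V m n \<Longrightarrow> grid_adj (\<psi> u) (\<psi> v) \<longleftrightarrow> grid_adj u v"
  shows "gatherable_1crash m n k pos0"
proof -
  let ?V = "grid_V m n" and ?V' = "grid_V m' n'"
  obtain A' where A': "valid_algo m' n' A'"
    and gA': "\<And>sched crash P D. admissible k sched crash \<Longrightarrow>
      execution m' n' k A' (\<psi> \<circ> pos0) sched P D \<Longrightarrow> gathered k crash P"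
    using gath unfolding gatherable_1crash_def by blast
  have inj_psi: "inj_on \<psi> ?V" by (rule inj_on_inverseI) (rule inv)
  \<comment> \<open>The translated snapshot is 0 outside the grid, as in \<open>look_result\<close>,
    so that \<open>A'\<close> receives the same function and not merely the same values on the
    grid.\<close>
  define A where "A g u = \<psi>' (A' (\<lambda>x. if x \<in> ?V' then g (\<psi>' x) else 0) (\<psi> u))" for g u
  have A'V: "A' g u \<in> ?V'" "A' g u = u \<or> grid_adj u (A' g u)" if "u \<in> ?V'" for g u
    using A' that unfolding valid_algo_def by blast+
  have AV: "A g u \<in> ?V" if "u \<in> ?V" for g u
    unfolding A_def using A'V psi psi' that by blast
  have "valid_algo m n A"
    unfolding valid_algo_def
  proof (intro allI ballI conjI)
    fix g u assume u: "u \<in> ?V"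
    show "A g u \<in> ?V" by (rule AV[OF u])
    have "\<psi> (A g u) = \<psi> u \<or> grid_adj (\<psi> u) (\<psi> (A g u))"
      using A'V[OF psi[OF u]] inv' unfolding A_def by metis
    then show "A g u = u \<or> grid_adj u (A g u)"
      using adj[OF u AV[OF u]] inv[OF u] inv[OF AV[OF u]] by metis
  qed
  moreover have "gathered k crash P"
    if adm: "admissible k sched crash" and ex: "execution m n k A pos0 sched P D" for sched crash P D
  proof -
    have sched: "sched i < k" for i using adm unfolding admissible_def by blast
    have ex0: "P 0 = pos0" "D 0 = (\<lambda>r. None)" using ex unfolding execution_def by blast+
    have exS: "case D i (sched i) of
        None \<Rightarrow> P (Suc i) = P i \<and>
               (\<exists>d. D (Suc i) = (D i)(sched i := Some d) \<and> look_result m n k A (P i) (P i (sched i)) d)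
      | Some w \<Rightarrow> P (Suc i) = (P i)(sched i := w) \<and> D (Suc i) = (D i)(sched i := None)" for i
      using ex unfolding execution_def by blast
    have lookV: "d \<in> ?V" if l: "look_result m n k A pos v d" for pos v d
    proof -
      obtain \<tau> u where "grid_aut m n \<tau>" and u: "u \<in> ?V"
        and d: "d = \<tau> (A (\<lambda>x. if x \<in> ?V then config_of k pos (\<tau> x) else 0) u)"
        using l unfolding look_result_def by blast
      then have "bij_betw \<tau> ?V ?V" unfolding grid_aut_def by blast
      then show ?thesis unfolding d using AV[OF u] by (blast dest: bij_betwE)
    qed
    \<comment> \<open>\<open>\<psi>\<close> is controlled only on grid nodes, so positions and
      pending destinations must be confined to them.\<close>
    have inV: "\<forall>r<k. P i r \<in> ?V \<and> (\<forall>d. D i r = Some d \<longrightarrow> d \<in> ?V)" for i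
    proof (induction i)
      case 0
      then show ?case using ex0 pos0 by auto
    next
      case (Suc i)
      show ?case
      proof (cases "D i (sched i)")
        case None
        then have "P (Suc i) = P i \<and> (\<exists>d. D (Suc i) = (D i)(sched i := Some d) \<and>
            look_result m n k A (P i) (P i (sched i)) d)"
          using exS[of i] by simp
        then obtain d where "P (Suc i) = P i" "D (Suc i) = (D i)(sched i := Some d)" "d \<in> ?V"
          using lookV by blast
        then show ?thesis using Suc by (simp del: mem_grid_V split_paired_All)
      next
        case (Some w)
        then have "w \<in> ?V" using Suc sched by blast
        moreover have "P (Suc i) = (P i)(sched i := w)" "D (Suc i) = (D i)(sched i := None)"
          using exS[of i] Some by simp_all
        ultimately show ?thesis using Suc by (simp del: mem_grid_V split_paired_All)
      qed
    qed
    let ?P = "\<lambda>i. \<psi> \<circ> P i" and ?D = "\<lambda>i r. map_option \<psi> (D i r)"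
    have look: "look_result m' n' k A' (\<psi> \<circ> pos) (\<psi> v) (\<psi> d)"
      if l: "look_result m n k A pos v d" and pos: "\<forall>r<k. pos r \<in> ?V" for pos v d
    proof -
      obtain \<tau> u where t: "grid_aut m n \<tau>" "u \<in> ?V" "\<tau> u = v"
        "d = \<tau> (A (\<lambda>x. if x \<in> ?V then config_of k pos (\<tau> x) else 0) u)"
        using l unfolding look_result_def by blast
      have bij: "bij_betw \<tau> ?V ?V"
        and tadj: "\<And>u v. u \<in> ?V \<Longrightarrow> v \<in> ?V \<Longrightarrow> grid_adj u v \<longleftrightarrow> grid_adj (\<tau> u) (\<tau> v)"
        using t(1) unfolding grid_aut_def by blast+
      have tV: "\<tau> x \<in> ?V" if "x \<in> ?V" for x using bij that by (metis bij_betwE)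
      have bpsi: "bij_betw \<psi> ?V ?V'" "bij_betw \<psi>' ?V' ?V"
        using psi psi' inv inv' by - (rule bij_betw_byWitness[where f' = \<psi>'], blast+, rule bij_betw_byWitness[where f' = \<psi>], blast+)
      \<comment> \<open>Conjugation turns the frame chosen by the adversary into a frame of the
        other grid.\<close>
      let ?t = "\<psi> \<circ> \<tau> \<circ> \<psi>'"
      have "bij_betw ?t ?V' ?V'"
        using bij_betw_trans[OF bij_betw_trans[OF bpsi(2) bij] bpsi(1)] by (simp add: comp_assoc)
      moreover have "grid_adj u v \<longleftrightarrow> grid_adj (?t u) (?t v)" if uv: "u \<in> ?V'" "v \<in> ?V'" for u v
        using adj[OF tV[OF psi'[OF uv(1)]] tV[OF psi'[OF uv(2)]]] tadj[OF psi'[OF uv(1)] psi'[OF uv(2)]]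
          adj[OF psi'[OF uv(1)] psi'[OF uv(2)]] inv'[OF uv(1)] inv'[OF uv(2)] by (simp del: mem_grid_V)
      ultimately have "grid_aut m' n' ?t" unfolding grid_aut_def by blast
      moreover have cfg: "config_of k (\<psi> \<circ> pos) (\<psi> x) = config_of k pos x" if "x \<in> ?V" for x
      proof -
        have "{r. r < k \<and> (\<psi> \<circ> pos) r = \<psi> x} = {r. r < k \<and> pos r = x}"
          using pos that inj_psi by (auto simp del: mem_grid_V dest: inj_onD)
        then show ?thesis by (simp add: config_of_def)
      qed
      have "(\<lambda>x. if x \<in> ?V' then config_of k (\<psi> \<circ> pos) (?t x) else 0) =
          (\<lambda>x. if x \<in> ?V' then (\<lambda>x. if x \<in> ?V then config_of k pos (\<tau> x) else 0) (\<psi>' x) else 0)"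
        (is "?l = ?r")
      proof
        fix x show "?l x = ?r x"
          using cfg[of "\<tau> (\<psi>' x)"] tV[of "\<psi>' x"] psi'[of x] by (simp del: mem_grid_V)
      qed
      then have "\<psi> d = ?t (A' (\<lambda>x. if x \<in> ?V' then config_of k (\<psi> \<circ> pos) (?t x) else 0) (\<psi> u))"
        unfolding t(4) A_def by simp
      ultimately show ?thesis
        unfolding look_result_def using t(2,3) inv[OF t(2)] psi[OF t(2)]
        by (intro exI[of _ ?t] exI[of _ "\<psi> u"]) (simp del: mem_grid_V)
    qed
    have "execution m' n' k A' (\<psi> \<circ> pos0) sched ?P ?D"
      unfolding execution_def
    proof (intro conjI allI)
      fix i
      show "case ?D i (sched i) of
        None \<Rightarrow> ?P (Suc i) = ?P i \<and>
               (\<exists>d. ?D (Suc i) = (?D i)(sched i := Some d) \<and>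
                 look_result m' n' k A' (?P i) (?P i (sched i)) d)
      | Some w \<Rightarrow> ?P (Suc i) = (?P i)(sched i := w) \<and> ?D (Suc i) = (?D i)(sched i := None)"
      proof (cases "D i (sched i)")
        case None
        then have "P (Suc i) = P i \<and> (\<exists>d. D (Suc i) = (D i)(sched i := Some d) \<and>
            look_result m n k A (P i) (P i (sched i)) d)"
          using exS[of i] by simp
        then obtain d where d: "P (Suc i) = P i" "D (Suc i) = (D i)(sched i := Some d)"
          "look_result m n k A (P i) (P i (sched i)) d" by blast
        have "look_result m' n' k A' (?P i) (?P i (sched i)) (\<psi> d)"
          using look[OF d(3)] inV[of i] by (simp del: mem_grid_V)
        moreover have "?D (Suc i) = (?D i)(sched i := Some (\<psi> d))" using d(2) by auto
        moreover have "?D i (sched i) = None" "?P (Suc i) = ?P i" using None d(1) by simp_all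
        ultimately show ?thesis by (simp only: option.case) blast
      next
        case (Some w)
        moreover have "P (Suc i) = (P i)(sched i := w)" "D (Suc i) = (D i)(sched i := None)"
          using exS[of i] Some by simp_all
        ultimately show ?thesis by auto
      qed
    qed (use ex0 in auto)
    then have "gathered k crash ?P" using gA' adm by blast
    then show ?thesis unfolding gathered_def comp_apply using inV inj_psi by (meson inj_onD)
  qed
  ultimately show ?thesis unfolding gatherable_1crash_def by blast
qed

section \<open>The gathering algorithm\<close>

text \<open>With the even side along x, \<open>flip_x\<close> exchanges the two ends of the axis
  \<open>snd v = c\<close> and fixes no node, whereas \<open>flip_y\<close> fixes the axis
  pointwise.\<close>

locale even_odd_grid =
  fixes m n c :: nat
  assumes even_m: "even m" and m_pos: "0 < m" and n_eq: "n = 2 * c + 1"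
begin

abbreviation V :: "node set" where "V \<equiv> grid_V m n"
abbreviation fx :: "node \<Rightarrow> node" where "fx \<equiv> flip_x m"
abbreviation fy :: "node \<Rightarrow> node" where "fy \<equiv> flip_y n"

definition goal :: node where "goal = (0, c)"
definition antigoal :: node where "antigoal = (m - 1, c)"

definition parent :: "node \<Rightarrow> node" where
  "parent v = (if 0 < fst v then (fst v - 1, snd v)
     else if snd v < c then (0, snd v + 1)
     else if c < snd v then (0, snd v - 1) else v)"

text \<open>The factor \<open>n\<close> exceeds every distance from the axis, so nodes are ordered
  by x first and by that distance second.\<close>

definition rank :: "node \<Rightarrow> nat" where
  "rank v = fst v * n + (if snd v \<le> c then c - snd v else snd v - c)"

text \<open>Row 0 gets the largest keys, and within a row the nodes near the axis do. In contrast to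
  the key, the rank does not separate mirror images under the flip of y.\<close>
definition key :: "node \<Rightarrow> nat" where
  "key v = (m - 1 - fst v) * n + (if snd v \<le> c then 2 * snd v else 2 * (n - 1 - snd v) + 1)"

text \<open>\<open>\<tau>\<close> selects the corner from which the configuration is read; for
  entries 0 and 1 the result is a binary numeral.\<close>

definition weight :: "(node \<Rightarrow> node) \<Rightarrow> config \<Rightarrow> nat" where
  "weight \<tau> g = (\<Sum>v\<in>V. g v * 2 ^ key (\<tau> v))"

text \<open>The maxima make the comparison insensitive to \<open>fy\<close>, which a local frame may
  apply unnoticed.\<close>

definition oriented :: "config \<Rightarrow> bool" where
  "oriented g \<longleftrightarrow> g antigoal < g goal \<or>
     g antigoal = g goal \<and>
     max (weight fx g) (weight (fx \<circ> fy) g) < max (weight id g) (weight fy g)"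

text \<open>Capping counts at 2 does not affect a test against 1. Since the antigoal is left out of
  the sum, the nearest robot on neither end may move even when both ends are occupied and it starts
  in the last row.\<close>

definition mover :: "config \<Rightarrow> node \<Rightarrow> bool" where
  "mover g u \<longleftrightarrow> g antigoal < g goal \<or> u = antigoal \<or>
     (\<Sum>v | v \<in> V \<and> v \<noteq> antigoal \<and> rank v < rank u. g v) \<le> 1"

definition step :: "config \<Rightarrow> node \<Rightarrow> node" where
  "step g u = (if mover g u then parent u else u)"

text \<open>If the frame exchanges the ends, the decision is made on the reflected snapshot and
  reflected back. Staying is the default when neither end is selected.\<close>

definition algo :: "config \<Rightarrow> node \<Rightarrow> node" where
  "algo g u = (if oriented g then step g u
     else if oriented (g \<circ> fx) then fx (step (g \<circ> fx) (fx u)) else u)"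

section \<open>Reflections, descent towards the goal, and the numberings of nodes\<close>

lemma m_ge: "2 \<le> m"
  using even_m m_pos by presburger

lemma n_pos: "0 < n"
  using n_eq by simp

lemma m_ne_n: "m \<noteq> n"
  using even_m n_eq by auto

lemma goal_in [simp]: "goal \<in> V" and antigoal_in [simp]: "antigoal \<in> V"
  using m_pos n_eq by (auto simp: goal_def antigoal_def)

lemma goal_ne_antigoal: "goal \<noteq> antigoal"
  using m_ge by (simp add: goal_def antigoal_def)

lemma fx_in: "v \<in> V \<Longrightarrow> fx v \<in> V" and fy_in: "v \<in> V \<Longrightarrow> fy v \<in> V"
  by (auto simp: flip_x_def flip_y_def)

lemma fx_fx: "v \<in> V \<Longrightarrow> fx (fx v) = v" and fy_fy: "v \<in> V \<Longrightarrow> fy (fy v) = v"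
  by (auto simp: flip_x_def flip_y_def)

lemma fx_fy: "fx (fy v) = fy (fx v)"
  by (simp add: flip_x_def flip_y_def)

lemma fx_goal: "fx goal = antigoal" "fx antigoal = goal"
  by (auto simp: flip_x_def goal_def antigoal_def)

lemma fy_goal: "fy goal = goal" "fy antigoal = antigoal"
  using n_eq by (auto simp: flip_y_def goal_def antigoal_def)

lemma fy_eq_antigoal: "v \<in> V \<Longrightarrow> fy v = antigoal \<longleftrightarrow> v = antigoal"
  using fy_fy fy_goal by metis

text \<open>A fixed node would satisfy \<open>2 * fst v = m - 1\<close>, but the right-hand side is
  odd.\<close>

lemma fx_no_fixpoint: "v \<in> V \<Longrightarrow> fx v \<noteq> v"
  using even_m by (cases v) (auto simp: flip_x_def, presburger)

lemma fx_fy_no_fixpoint: "v \<in> V \<Longrightarrow> fx (fy v) \<noteq> v"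
  using even_m by (cases v) (auto simp: flip_x_def flip_y_def, presburger)

lemma bij_fx: "bij_betw fx V V"
  using fx_in fx_fx by (auto intro!: bij_betw_byWitness[where f' = fx] simp del: mem_grid_V)

lemma bij_fy: "bij_betw fy V V"
  using fy_in fy_fy by (auto intro!: bij_betw_byWitness[where f' = fy] simp del: mem_grid_V)

lemma row_major_less:
  fixes a b s t :: nat
  assumes "a < b" "s < n"
  shows "a * n + s < b * n + t"
proof -
  have "a * n + s < Suc a * n" using assms by simp
  also have "\<dots> \<le> b * n" using assms by (intro mult_le_mono1) simp
  finally show ?thesis by simp
qed

lemma parent_in: "v \<in> V \<Longrightarrow> parent v \<in> V"
  using n_eq by (auto simp: parent_def)

lemma parent_adj: "parent v = v \<or> grid_adj v (parent v)"
  by (auto simp: parent_def grid_adj_def)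

lemma parent_goal [simp]: "parent goal = goal"
  by (simp add: parent_def goal_def)

lemma parent_eq_self: "parent v = v \<longleftrightarrow> v = goal"
  by (cases v) (auto simp: parent_def goal_def)

lemma parent_ne_antigoal: "v \<in> V \<Longrightarrow> parent v \<noteq> antigoal"
  using m_ge by (cases v) (auto simp: parent_def antigoal_def)

lemma parent_fy: "v \<in> V \<Longrightarrow> parent (fy v) = fy (parent v)"
  using n_eq by (cases v) (auto simp: parent_def flip_y_def)

lemma rank_fy: "v \<in> V \<Longrightarrow> rank (fy v) = rank v"
  unfolding rank_def flip_y_def using n_eq by auto

lemma rank_parent_less: "v \<in> V \<Longrightarrow> v \<noteq> goal \<Longrightarrow> rank (parent v) < rank v"
proof (cases v)
  case (Pair x y)
  assume v: "v \<in> V" "v \<noteq> goal"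
  show ?thesis
  proof (cases "0 < x")
    case True
    then show ?thesis using n_pos Pair by (cases x) (auto simp: parent_def rank_def)
  next
    case False
    then show ?thesis using v Pair by (auto simp: parent_def rank_def goal_def)
  qed
qed

text \<open>Equal ranks leave only mirror images under \<open>fy\<close>, and fixing the side of the
  axis separates these.\<close>

lemma rank_inj:
  assumes "u \<in> V" "v \<in> V" "rank u = rank v" "(snd u \<le> c) = (snd v \<le> c)"
  shows "u = v"
proof -
  obtain a b x y where uv: "u = (a,b)" "v = (x,y)" by fastforce
  let ?d = "\<lambda>b. if b \<le> c then c - b else b - c"
  have d: "?d b < n" "?d y < n" using assms n_eq uv by auto
  have eq: "a * n + ?d b = x * n + ?d y" using assms(3) by (simp only: rank_def uv fst_conv snd_conv)
  have "a = x"
    using row_major_less[of a x "?d b" "?d y"] row_major_less[of x a "?d y" "?d b"] d eq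
    by (metis less_irrefl nat_neq_iff)
  then show ?thesis using eq assms(4) uv by (auto split: if_splits)
qed

text \<open>Nodes up to the axis get even offsets and nodes beyond it odd ones, all below
  \<open>n\<close>; parity separates the two sides.\<close>

lemma key_inj: "inj_on key V"
proof (rule inj_onI)
  fix u v assume uv: "u \<in> V" "v \<in> V" "key u = key v"
  obtain a b x y where p: "u = (a,b)" "v = (x,y)" by fastforce
  let ?d = "\<lambda>b. if b \<le> c then 2 * b else 2 * (n - 1 - b) + 1"
  have d: "?d b < n" "?d y < n" using uv n_eq p by auto
  have eq: "(m - 1 - a) * n + ?d b = (m - 1 - x) * n + ?d y" using uv(3) by (simp only: key_def p fst_conv snd_conv)
  have "m - 1 - a = m - 1 - x"
    using row_major_less[of "m-1-a" "m-1-x" "?d b" "?d y"] row_major_less[of "m-1-x" "m-1-a" "?d y" "?d b"] d eq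
    by (metis less_irrefl nat_neq_iff)
  then have "a = x" "?d b = ?d y" using eq uv p by auto
  then show "u = v" using uv p by (auto split: if_splits) presburger+
qed

lemma key_parent_less:
  assumes v: "v \<in> V" "v \<noteq> goal"
  shows "key v < key (parent v)"
proof (cases v)
  case (Pair x y)
  show ?thesis
  proof (cases "0 < x")
    case True
    then have "m - 1 - (x - 1) = Suc (m - 1 - x)" using v Pair by auto
    then show ?thesis using True n_pos Pair by (simp add: parent_def key_def)
  next
    case False
    then show ?thesis using v Pair n_eq unfolding parent_def key_def goal_def by auto
  qed
qed

lemma key_row_less:
  assumes "v \<in> V" "fst u < fst v"
  shows "key v < key u"
  unfolding key_def
proof (rule row_major_less)
  show "m - 1 - fst v < m - 1 - fst u" using assms by auto
  show "(if snd v \<le> c then 2 * snd v else 2 * (n - 1 - snd v) + 1) < n" using assms n_eq by auto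
qed

text \<open>The gain of a move in either reading from the goal side outweighs its gain in
  either reading from the opposite side. For horizontal moves the latter is negative;
  moves inside row 0 become moves in the last row, which carries the smallest keys.\<close>
lemma key_gain:
  assumes v: "v \<in> V" "v \<noteq> goal" and s: "s \<in> {id, fy}" and t: "t \<in> {fx, fx \<circ> fy}"
  shows "(2::nat) ^ key (t (parent v)) + 2 ^ key (s v) \<le> 2 ^ key (t v) + 2 ^ key (s (parent v))"
proof -
  have fy: "fy v \<in> V" "fy v \<noteq> goal" using v fy_in fy_fy fy_goal by metis+
  have par: "parent (fy v) = fy (parent v)" by (rule parent_fy[OF v(1)])
  have less: "key (s v) < key (s (parent v))"
    using s key_parent_less[OF v] key_parent_less[OF fy] par by auto
  show ?thesis
  proof (cases "0 < fst v")
    case True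
    have fst_par: "fst (parent v) = fst v - 1" "snd (parent v) = snd v" using True by (simp_all add: parent_def)
    have "key (t (parent v)) < key (t v)"
      using t True fst_par v(1) by (intro key_row_less) (auto simp: flip_x_def flip_y_def)
    then have "(2::nat) ^ key (t (parent v)) \<le> 2 ^ key (t v)" "(2::nat) ^ key (s v) \<le> 2 ^ key (s (parent v))"
      using less by (simp_all add: power_increasing)
    then show ?thesis by linarith
  next
    case False
    then have fst: "fst (s v) = 0" "fst (t (parent v)) = m - 1"
      using s t by (auto simp: parent_def flip_x_def flip_y_def)
    have "fx (parent v) \<in> V" "fx (fy (parent v)) \<in> V"
      using parent_in[OF v(1)] fx_in fy_in by blast+
    then have "t (parent v) \<in> V" using t by auto
    then have "key (t (parent v)) < key (s v)" using fst m_ge by (intro key_row_less) auto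
    \<comment> \<open>Twice \<open>2 ^ key (s v)\<close> is at most
      \<open>2 ^ key (s (parent v))\<close>, which pays for both terms on the left of the
      claim.\<close>
    then have "(2::nat) ^ key (t (parent v)) \<le> 2 ^ key (s v)" "(2::nat) ^ Suc (key (s v)) \<le> 2 ^ key (s (parent v))"
      using less by (intro power_increasing; simp)+
    then show ?thesis unfolding power_Suc by linarith
  qed
qed

section \<open>Weights, orientation and moves under reflections\<close>

lemma weight_cong: "(\<And>v. v \<in> V \<Longrightarrow> g v = h v) \<Longrightarrow> weight \<tau> g = weight \<tau> h"
  unfolding weight_def by (intro sum.cong) auto

text \<open>Change of summation variable: reading a reflected configuration from one corner is
  reading the original from another.\<close>

lemma weight_reindex:
  assumes "bij_betw \<phi> V V" and "\<And>v. v \<in> V \<Longrightarrow> \<tau>' v = \<tau> (\<phi> v)"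
    and "\<And>v. v \<in> V \<Longrightarrow> h v = g (\<phi> v)"
  shows "weight \<tau>' h = weight \<tau> g"
proof -
  have "weight \<tau>' h = (\<Sum>v\<in>V. g (\<phi> v) * 2 ^ key (\<tau> (\<phi> v)))"
    unfolding weight_def using assms(2,3) by (intro sum.cong) auto
  also have "\<dots> = weight \<tau> g"
    unfolding weight_def by (rule sum.reindex_bij_betw[OF assms(1), of "\<lambda>v. g v * 2 ^ key (\<tau> v)"])
  finally show ?thesis .
qed

lemma oriented_cong: "(\<And>v. v \<in> V \<Longrightarrow> g v = h v) \<Longrightarrow> oriented g \<longleftrightarrow> oriented h"
  using weight_cong[of g h] goal_in antigoal_in unfolding oriented_def by presburger

text \<open>\<open>fy\<close> fixes both ends and only swaps the two readings inside each
  maximum.\<close>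

lemma oriented_fy:
  assumes "\<And>v. v \<in> V \<Longrightarrow> h v = g (fy v)"
  shows "oriented h \<longleftrightarrow> oriented g"
proof -
  have "weight id h = weight fy g"
    using assms fy_fy by (intro weight_reindex[OF bij_fy]) simp_all
  moreover have "weight fy h = weight id g"
    using assms by (intro weight_reindex[OF bij_fy]) simp_all
  moreover have "weight fx h = weight (fx \<circ> fy) g"
    using assms fy_fy by (intro weight_reindex[OF bij_fy]) simp_all
  moreover have "weight (fx \<circ> fy) h = weight fx g"
    using assms by (intro weight_reindex[OF bij_fy]) simp_all
  ultimately show ?thesis
    using assms[OF goal_in] assms[OF antigoal_in] fy_goal unfolding oriented_def by (simp add: max.commute)
qed

text \<open>\<open>fx\<close> swaps the ends together with their pairs of readings, which reverses
  the comparison. Hence a configuration and its reflection are never both oriented.\<close>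

lemma oriented_fx:
  assumes "\<And>v. v \<in> V \<Longrightarrow> h v = g (fx v)"
  shows "oriented h \<longleftrightarrow> g goal < g antigoal \<or> g antigoal = g goal \<and>
     max (weight id g) (weight fy g) < max (weight fx g) (weight (fx \<circ> fy) g)"
proof -
  have "weight id h = weight fx g"
    using assms fx_fx by (intro weight_reindex[OF bij_fx]) simp_all
  moreover have "weight fy h = weight (fx \<circ> fy) g"
  proof (rule weight_reindex[OF bij_fx])
    fix v assume v: "v \<in> V"
    show "fy v = (fx \<circ> fy) (fx v)" using fx_fx[OF fy_in[OF v]] fx_fy[of v] fx_fy[of "fx v"] by simp
  qed (rule assms)
  moreover have "weight fx h = weight id g"
    using assms by (intro weight_reindex[OF bij_fx]) simp_all
  moreover have "weight (fx \<circ> fy) h = weight fy g"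
    using assms fx_fy by (intro weight_reindex[OF bij_fx]) simp_all
  ultimately show ?thesis
    using assms[OF goal_in] assms[OF antigoal_in] fx_goal unfolding oriented_def by auto
qed

lemma mover_cong: "(\<And>v. v \<in> V \<Longrightarrow> g v = h v) \<Longrightarrow> mover g u \<longleftrightarrow> mover h u"
  using goal_in antigoal_in sum.cong[of "{v. v \<in> V \<and> v \<noteq> antigoal \<and> rank v < rank u}" _ g h]
  unfolding mover_def by (metis (mono_tags, lifting) mem_Collect_eq)

lemma mover_fy:
  assumes h: "\<And>v. v \<in> V \<Longrightarrow> h v = g (fy v)" and u: "u \<in> V"
  shows "mover h u \<longleftrightarrow> mover g (fy u)"
proof -
  let ?S = "{v. v \<in> V \<and> v \<noteq> antigoal \<and> rank v < rank u}"
  have "bij_betw fy ?S ?S"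
    using fy_in fy_fy fy_eq_antigoal rank_fy
    by (intro bij_betw_byWitness[where f' = fy] ballI image_subsetI) (simp_all del: mem_grid_V)
  then have "sum g ?S = (\<Sum>v\<in>?S. g (fy v))" by (rule sum.reindex_bij_betw[symmetric])
  also have "\<dots> = sum h ?S" using h by (intro sum.cong) auto
  finally show ?thesis
    using h[OF goal_in] h[OF antigoal_in] fy_goal fy_eq_antigoal[OF u] rank_fy[OF u]
    unfolding mover_def by simp
qed

lemma step_fy:
  assumes h: "\<And>v. v \<in> V \<Longrightarrow> h v = g (fy v)" and u: "u \<in> V"
  shows "step h u = fy (step g (fy u))"
  unfolding step_def using mover_fy[of h g, OF h u] parent_fy[OF u] fy_fy[OF u] fy_fy[OF parent_in[OF u]]
  by simp

lemma step_cong: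
  assumes "\<And>v. v \<in> V \<Longrightarrow> g v = h v"
  shows "step g u = step h u"
  unfolding step_def using mover_cong[OF assms] by simp

lemma step_in: "u \<in> V \<Longrightarrow> step g u \<in> V"
  unfolding step_def using parent_in by simp

lemma step_adj: "step g u = u \<or> grid_adj u (step g u)"
  unfolding step_def using parent_adj by simp

section \<open>The move computed in an arbitrary local frame\<close>

lemma valid_algo: "valid_algo m n algo"
  unfolding valid_algo_def
proof (intro allI ballI conjI)
  fix g u assume u: "u \<in> V"
  let ?w = "step (g \<circ> fx) (fx u)"
  have w: "?w \<in> V" by (rule step_in[OF fx_in[OF u]])
  show "algo g u \<in> V"
    unfolding algo_def using u step_in[OF u] fx_in[OF w] by presburger
  have "grid_adj (fx u) ?w \<longleftrightarrow> grid_adj (fx (fx u)) (fx ?w)"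
    using grid_aut_flip_x[of m n] fx_in[OF u] w unfolding grid_aut_def by blast
  then have "fx ?w = u \<or> grid_adj u (fx ?w)"
    using step_adj[of "g \<circ> fx" "fx u"] fx_fx[OF u] by metis
  then show "algo g u = u \<or> grid_adj u (algo g u)"
    unfolding algo_def using step_adj[of g u] by presburger
qed

text \<open>There are only four frames: under two of them the snapshot stays oriented, under the
  other two its \<open>fx\<close> image is, and \<open>step\<close> commutes with \<open>fy\<close>.
  So the choice of frame cannot influence the destination.\<close>

lemma look_result_oriented:
  assumes look: "look_result m n k algo pos v d" and ori: "oriented (config_of k pos)"
  shows "d = step (config_of k pos) v"
proof -
  let ?f = "config_of k pos"
  obtain \<tau> u where t: "grid_aut m n \<tau>" and u: "u \<in> V" and v: "\<tau> u = v"
    and d: "d = \<tau> (algo (\<lambda>x. if x \<in> V then ?f (\<tau> x) else 0) u)"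
    using look unfolding look_result_def by blast
  define g where "g = (\<lambda>x. if x \<in> V then ?f (\<tau> x) else 0)"
  have g: "g x = ?f (\<tau> x)" if "x \<in> V" for x using that by (simp add: g_def)
  have d: "d = \<tau> (algo g u)" using d by (simp add: g_def)
  \<comment> \<open>In frames that exchange the ends, this forces \<open>algo\<close> into its
    second branch.\<close>
  have not_ori: "\<not> oriented (\<lambda>v. ?f (fx v))"
    using oriented_fx[of "\<lambda>v. ?f (fx v)" ?f] ori unfolding oriented_def by auto
  show ?thesis
  proof (rule grid_aut_cases[OF t m_ne_n m_pos n_pos])
    assume tau: "\<forall>v\<in>V. \<tau> v = v"
    then have "oriented g" using ori g oriented_cong[of g ?f] by simp
    then show ?thesis
      using tau u v d g step_in[OF u] step_cong[of g ?f u] unfolding algo_def by (simp del: mem_grid_V)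
  next
    assume tau: "\<forall>v\<in>V. \<tau> v = fy v"
    then have g': "g v = ?f (fy v)" if "v \<in> V" for v using g that by simp
    then have "oriented g" using ori oriented_fy[of g ?f] by simp
    then have "algo g u = fy (step ?f (fy u))"
      using step_fy[of g ?f, OF g' u] by (simp add: algo_def)
    moreover have "fy (step ?f (fy u)) \<in> V" by (intro fy_in step_in u)
    ultimately show ?thesis
      using tau u v d fy_fy step_in[OF fy_in[OF u]] by (simp del: mem_grid_V)
  next
    assume tau: "\<forall>v\<in>V. \<tau> v = fx v"
    then have g': "g v = ?f (fx v)" if "v \<in> V" for v using g that by simp
    then have gfx: "(g \<circ> fx) v = ?f v" if "v \<in> V" for v using fx_in fx_fx that by (simp del: mem_grid_V)
    have "\<not> oriented g" using not_ori oriented_cong[of g, OF g'] by simp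
    moreover have "oriented (g \<circ> fx)" using ori oriented_cong[of "g \<circ> fx" ?f, OF gfx] by simp
    ultimately have "algo g u = fx (step ?f (fx u))"
      using step_cong[of "g \<circ> fx" ?f "fx u", OF gfx] by (simp add: algo_def)
    moreover have "fx (step ?f (fx u)) \<in> V" by (intro fx_in step_in u)
    ultimately show ?thesis
      using tau u v d fx_fx step_in[OF fx_in[OF u]] by (simp del: mem_grid_V)
  next
    assume tau: "\<forall>v\<in>V. \<tau> v = fx (fy v)"
    then have g': "g v = ?f (fx (fy v))" if "v \<in> V" for v using g that by simp
    then have gfx: "(g \<circ> fx) v = ?f (fy v)" if "v \<in> V" for v
      using fx_in[OF that] fx_fx[OF fy_in[OF that]] fx_fy[of "fx v"] fx_fx[OF that] by (simp del: mem_grid_V)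
    have "oriented g \<longleftrightarrow> oriented (\<lambda>v. ?f (fx v))"
      by (rule oriented_fy) (rule g')
    then have "\<not> oriented g" using not_ori by simp
    moreover have "oriented (g \<circ> fx)" using ori oriented_fy[of "g \<circ> fx" ?f, OF gfx] by simp
    ultimately have "algo g u = fx (fy (step ?f (fy (fx u))))"
      using step_fy[of "g \<circ> fx" ?f, OF gfx fx_in[OF u]] by (simp add: algo_def)
    moreover have "step ?f (fy (fx u)) \<in> V" by (intro fx_in fy_in step_in u)
    ultimately show ?thesis
      using tau u v d fx_fx fy_fy fx_in fy_in fx_fy by (simp del: mem_grid_V)
  qed
qed

text \<open>With entries 0 and 1 and distinct keys, the weight is the \<open>set_encode\<close>
  value of the set of occupied keys.\<close>

lemma weight_id_inj:
  assumes g: "\<And>v. g v \<le> 1" and h: "\<And>v. h v \<le> 1" and eq: "weight id g = weight id h"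
    and v: "v \<in> V"
  shows "g v = h v"
proof -
  have enc: "weight id f = set_encode (key ` {v \<in> V. f v = 1})" if f: "\<And>v. f v \<le> 1" for f :: config
  proof -
    have inj: "inj_on key {v \<in> V. f v = 1}" using key_inj by (rule inj_on_subset) blast
    have "f v = 0 \<or> f v = 1" for v using f[of v] by linarith
    then have "f v * 2 ^ key v = (if f v = 1 then 2 ^ key v else 0)" for v
      by (metis mult.left_neutral mult_zero_left zero_neq_one)
    then have "weight id f = (\<Sum>v\<in>V. if f v = 1 then 2 ^ key v else 0)"
      unfolding weight_def by (intro sum.cong) auto
    also have "\<dots> = (\<Sum>v\<in>{v \<in> V. f v = 1}. 2 ^ key v)"
      by (rule sum.inter_filter[symmetric]) simp
    also have "\<dots> = set_encode (key ` {v \<in> V. f v = 1})"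
      unfolding set_encode_def sum.reindex[OF inj] comp_def ..
    finally show ?thesis .
  qed
  have "key ` {v \<in> V. g v = 1} = key ` {v \<in> V. h v = 1}"
    using eq enc[of g] enc[of h] g h set_encode_eq by (metis (no_types, lifting) finite_grid_V finite_imageI finite_subset mem_Collect_eq subsetI)
  then have "{v \<in> V. g v = 1} = {v \<in> V. h v = 1}"
    using inj_on_image_eq_iff[OF key_inj] by (metis (no_types, lifting) mem_Collect_eq subsetI)
  then have "g v = 1 \<longleftrightarrow> h v = 1" using v by blast
  then show ?thesis using g[of v] h[of v] by linarith
qed

text \<open>Equality of a reading from one end with a reading from the other would make the
  configuration invariant under \<open>fx\<close> or under \<open>fx \<circ> fy\<close>.\<close>

lemma oriented_total:
  assumes le1: "\<And>v. g v \<le> 1"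
    and not_fx: "\<not> (\<forall>v\<in>V. g (fx v) = g v)" and not_fxy: "\<not> (\<forall>v\<in>V. g (fx (fy v)) = g v)"
  shows "oriented g \<or> oriented (g \<circ> fx)"
proof -
  have w_fx: "weight fx g = weight id (g \<circ> fx)"
    by (rule weight_reindex[OF bij_fx, symmetric]) (simp_all add: fx_fx del: mem_grid_V)
  have w_fy: "weight fy g = weight id (g \<circ> fy)"
    by (rule weight_reindex[OF bij_fy, symmetric]) (simp_all add: fy_fy del: mem_grid_V)
  have w_fxy: "weight (fx \<circ> fy) g = weight id (g \<circ> (fx \<circ> fy))"
  proof (rule weight_reindex[OF bij_betw_trans[OF bij_fy bij_fx], symmetric])
    fix v assume v: "v \<in> V"
    show "id v = (fx \<circ> fy) ((fx \<circ> fy) v)"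
      using fx_fy[of "fx (fy v)"] fx_fx[OF fy_in[OF v]] fy_fy[OF v] by simp
  qed simp
  have inj: "\<forall>v\<in>V. g (s v) = g (t v)" if "weight id (g \<circ> s) = weight id (g \<circ> t)" for s t
    using weight_id_inj[of "g \<circ> s" "g \<circ> t"] le1 that by simp
  have "weight id g \<noteq> weight fx g"
    using inj[of id fx] not_fx w_fx by auto
  moreover have "weight id g \<noteq> weight (fx \<circ> fy) g"
    using inj[of id "fx \<circ> fy"] not_fxy w_fxy by auto
  moreover have "weight fy g \<noteq> weight fx g"
  proof
    assume "weight fy g = weight fx g"
    then have "\<forall>v\<in>V. g (fy v) = g (fx v)" using inj[of fy fx] w_fx w_fy by simp
    then have "g (fx (fy v)) = g v" if "v \<in> V" for v
      using fy_in[OF that] fy_fy[OF that] by metis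
    then show False using not_fxy by blast
  qed
  moreover have "weight fy g \<noteq> weight (fx \<circ> fy) g"
  proof
    assume "weight fy g = weight (fx \<circ> fy) g"
    then have "\<forall>v\<in>V. g (fy v) = g (fx (fy v))" using inj[of fy "fx \<circ> fy"] w_fxy w_fy by simp
    then have "g (fx v) = g v" if "v \<in> V" for v
      using fy_in[OF that] fy_fy[OF that] by metis
    then show False using not_fx by blast
  qed
  \<comment> \<open>Equal maxima would force equality in one of the four pairs just
    excluded.\<close>
  ultimately have "max (weight id g) (weight fy g) \<noteq> max (weight fx g) (weight (fx \<circ> fy) g)"
    by (auto simp: max_def)
  then show ?thesis
    using oriented_fx[of "g \<circ> fx" g] unfolding oriented_def by auto
qed

end

section \<open>Executions with at most one crash\<close>

locale crash_execution = even_odd_grid +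
  fixes k :: nat and pos0 :: "nat \<Rightarrow> node" and sched :: "nat \<Rightarrow> nat" and crash :: "nat option"
    and P :: "nat \<Rightarrow> nat \<Rightarrow> node" and D :: "nat \<Rightarrow> nat \<Rightarrow> node option"
  assumes k_ge: "3 \<le> k"
    and inj_pos0: "inj_on pos0 {..<k}"
    and pos0_in: "\<And>r. r < k \<Longrightarrow> pos0 r \<in> V"
    and oriented_pos0: "oriented (config_of k pos0)"
    and admissible: "admissible k sched crash"
    and execution: "execution m n k algo pos0 sched P D"
begin

abbreviation cfg :: "nat \<Rightarrow> config" where "cfg i \<equiv> config_of k (P i)"

abbreviation robots_at :: "nat \<Rightarrow> node \<Rightarrow> nat set" where
  "robots_at i v \<equiv> {r. r < k \<and> P i r = v}"

abbreviation tie :: "nat \<Rightarrow> bool" where "tie i \<equiv> cfg i antigoal = cfg i goal"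

text \<open>Defined through starting positions, hence independent of time. The invariant says that
  only such robots have changed position while a tie lasts.\<close>

definition front :: "nat \<Rightarrow> bool" where
  "front r \<longleftrightarrow> card {s. s < k \<and> pos0 s \<noteq> antigoal \<and> rank (pos0 s) < rank (pos0 r)} \<le> 1"

text \<open>A coarse description of the path to the goal. The axis counts as belonging to the lower
  side, so a robot from beyond it changes side only on reaching \<open>goal\<close>, which is
  exempt.\<close>

definition reachable :: "nat \<Rightarrow> node \<Rightarrow> bool" where
  "reachable r v \<longleftrightarrow> v \<in> V \<and> (v = goal \<or> (snd v \<le> c) = (snd (pos0 r) \<le> c)) \<and>
     rank v \<le> rank (pos0 r) \<and> (v = antigoal \<longrightarrow> pos0 r = antigoal)"

text \<open>Pending destinations may stem from outdated snapshots. A robot that started on the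
  antigoal is exempt from the last clause: its departure may be pending, but carrying it out ends
  the tie.\<close>

definition robot_inv :: "nat \<Rightarrow> nat \<Rightarrow> bool" where
  "robot_inv i r \<longleftrightarrow> reachable r (P i r) \<and>
     D i r \<in> {None, Some (P i r), Some (parent (P i r))} \<and>
     (tie i \<longrightarrow> pos0 r = antigoal \<longrightarrow> P i r = antigoal) \<and>
     (tie i \<longrightarrow> \<not> front r \<longrightarrow> P i r = pos0 r) \<and>
     (tie i \<longrightarrow> \<not> front r \<longrightarrow> pos0 r \<noteq> antigoal \<longrightarrow> D i r \<in> {None, Some (P i r)})"

lemma reachable_parent:
  assumes "reachable r v"
  shows "reachable r (parent v)"
proof (cases "v = goal")
  case False
  have v: "v \<in> V" using assms unfolding reachable_def by blast
  have "parent v = goal \<or> (snd (parent v) \<le> c) = (snd v \<le> c)"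
    by (auto simp: parent_def goal_def)
  then show ?thesis
    using assms False rank_parent_less[OF v False] parent_in[OF v] parent_ne_antigoal[OF v]
    unfolding reachable_def by (metis le_trans less_imp_le_nat)
qed (use assms in simp)

lemma robot_invD:
  assumes "robot_inv i r"
  shows "reachable r (P i r)" "P i r \<in> V" "D i r \<in> {None, Some (P i r), Some (parent (P i r))}"
    "tie i \<Longrightarrow> pos0 r = antigoal \<Longrightarrow> P i r = antigoal"
    "tie i \<Longrightarrow> \<not> front r \<Longrightarrow> P i r = pos0 r"
    "tie i \<Longrightarrow> \<not> front r \<Longrightarrow> pos0 r \<noteq> antigoal \<Longrightarrow> D i r \<in> {None, Some (P i r)}"
    "rank (P i r) \<le> rank (pos0 r)" "P i r = antigoal \<Longrightarrow> pos0 r = antigoal"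
  using assms unfolding robot_inv_def reachable_def by blast+

text \<open>The last hypothesis expresses that ties are never regained, so the clauses about ties
  are inherited.\<close>

lemma robot_inv_unmoved:
  assumes "robot_inv i r" "P j r = P i r" "D j r \<in> {None, D i r}" "tie j \<Longrightarrow> tie i"
  shows "robot_inv j r"
proof -
  note r = robot_invD[OF assms(1)]
  have "D j r \<in> {None, Some (P i r), Some (parent (P i r))}" using r(3) assms(3) by auto
  moreover have "D j r \<in> {None, Some (P i r)}" if "tie j" "\<not> front r" "pos0 r \<noteq> antigoal"
    using r(6)[OF assms(4)] that assms(3) by auto
  ultimately show ?thesis
    unfolding robot_inv_def assms(2) using r(1,4,5) assms(4) by blast
qed

lemma robot_inv_moved:
  assumes "robot_inv i r" "P j r = parent (P i r)" "D j r = None"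
    and "tie j \<Longrightarrow> front r \<and> pos0 r \<noteq> antigoal"
  shows "robot_inv j r"
  unfolding robot_inv_def assms(2,3) using reachable_parent[OF robot_invD(1)[OF assms(1)]] assms(4) by blast

lemma sched_less: "sched i < k"
  using admissible unfolding admissible_def by blast

lemma init: "P 0 = pos0" "D 0 = (\<lambda>r. None)"
  using execution unfolding execution_def by blast+

lemma exec_look:
  assumes "D i (sched i) = None"
  shows "P (Suc i) = P i \<and> (\<exists>d. D (Suc i) = (D i)(sched i := Some d) \<and>
    look_result m n k algo (P i) (P i (sched i)) d)"
proof -
  have "case D i (sched i) of
        None \<Rightarrow> P (Suc i) = P i \<and>
               (\<exists>d. D (Suc i) = (D i)(sched i := Some d) \<and> look_result m n k algo (P i) (P i (sched i)) d)
      | Some w \<Rightarrow> P (Suc i) = (P i)(sched i := w) \<and> D (Suc i) = (D i)(sched i := None)"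
    using execution unfolding execution_def by blast
  then show ?thesis unfolding assms option.case .
qed

lemma exec_move:
  assumes "D i (sched i) = Some w"
  shows "P (Suc i) = (P i)(sched i := w)" "D (Suc i) = (D i)(sched i := None)"
proof -
  have "case D i (sched i) of
        None \<Rightarrow> P (Suc i) = P i \<and>
               (\<exists>d. D (Suc i) = (D i)(sched i := Some d) \<and> look_result m n k algo (P i) (P i (sched i)) d)
      | Some w \<Rightarrow> P (Suc i) = (P i)(sched i := w) \<and> D (Suc i) = (D i)(sched i := None)"
    using execution unfolding execution_def by blast
  then show "P (Suc i) = (P i)(sched i := w)" "D (Suc i) = (D i)(sched i := None)"
    unfolding assms option.case by blast+
qed

section \<open>Counting robots in spite of the cap\<close>

lemma cfg_eq: "cfg i v = min 2 (card (robots_at i v))"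
  by (simp add: config_of_def)

lemma sum_robots:
  fixes h :: "node \<Rightarrow> nat"
  assumes "\<And>r. r < k \<Longrightarrow> P i r \<in> V"
  shows "(\<Sum>v\<in>V. card (robots_at i v) * h v) = (\<Sum>r<k. h (P i r))"
proof -
  have "(\<Sum>r<k. h (P i r)) = (\<Sum>v\<in>V. \<Sum>r\<in>{r \<in> {..<k}. P i r = v}. h (P i r))"
    by (rule sum.group[symmetric]) (use assms in auto)
  also have "\<dots> = (\<Sum>v\<in>V. card (robots_at i v) * h v)"
    by (intro sum.cong) auto
  finally show ?thesis ..
qed

lemma cfg_sum_le:
  assumes "\<And>r. r < k \<Longrightarrow> P i r \<in> V"
  shows "(\<Sum>v | v \<in> V \<and> Q v. cfg i v) \<le> card {r. r < k \<and> Q (P i r)}"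
proof -
  have "(\<Sum>v | v \<in> V \<and> Q v. cfg i v) = (\<Sum>v\<in>V. if Q v then cfg i v else 0)"
    using sum.inter_filter[of V "cfg i" Q] by simp
  also have "\<dots> \<le> (\<Sum>v\<in>V. card (robots_at i v) * of_bool (Q v))"
    by (intro sum_mono) (auto simp: cfg_eq)
  also have "\<dots> = (\<Sum>r<k. of_bool (Q (P i r)))"
    by (rule sum_robots[OF assms])
  also have "\<dots> = card {r. r < k \<and> Q (P i r)}"
    by (simp add: of_bool_def sum.If_cases Int_def)
  finally show ?thesis .
qed

text \<open>Two robots on one node already show the value 2, and on different nodes each contributes
  at least 1; the cap cannot hide the second robot.\<close>

lemma cfg_sum_ge_2:
  assumes "a < k" "b < k" "a \<noteq> b" "P i a \<in> V" "P i b \<in> V" "Q (P i a)" "Q (P i b)"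
  shows "2 \<le> (\<Sum>v | v \<in> V \<and> Q v. cfg i v)"
proof (cases "P i a = P i b")
  case True
  have "card {a, b} \<le> card (robots_at i (P i a))"
    using assms True by (intro card_mono) auto
  then have "2 = cfg i (P i a)" using assms(3) by (simp add: cfg_eq)
  also have "\<dots> \<le> (\<Sum>v | v \<in> V \<and> Q v. cfg i v)"
    using assms by (intro member_le_sum) (auto intro: finite_subset[OF _ finite_grid_V[of m n]])
  finally show ?thesis .
next
  case False
  have one: "1 \<le> cfg i (P i r)" if "r < k" for r
  proof -
    have "card {r} \<le> card (robots_at i (P i r))" using that by (intro card_mono) auto
    then show ?thesis by (simp add: cfg_eq)
  qed
  have "2 \<le> (\<Sum>v\<in>{P i a, P i b}. cfg i v)"
    using False one[OF assms(1)] one[OF assms(2)] by simp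
  also have "\<dots> \<le> (\<Sum>v | v \<in> V \<and> Q v. cfg i v)"
    using assms by (intro sum_mono2) (auto intro: finite_subset[OF _ finite_grid_V[of m n]])
  finally show ?thesis .
qed

text \<open>Nobody enters the antigoal, so its occupants started there, on pairwise distinct
  nodes.\<close>

lemma card_antigoal_le_1:
  assumes "\<And>r. r < k \<Longrightarrow> robot_inv i r"
  shows "card (robots_at i antigoal) \<le> 1"
proof -
  have "a = b" if "a \<in> robots_at i antigoal" "b \<in> robots_at i antigoal" for a b
    using that assms[THEN robot_invD(8)] inj_onD[OF inj_pos0, of a b] by auto
  then show ?thesis using card_le_Suc0_iff_eq[of "robots_at i antigoal"] by simp
qed

text \<open>During a tie at most two robots meet outside the goal: robots that are not in front
  have not moved and are further away, and three robots in front starting on the same side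
  have distinct ranks, so the last of them had two robots ahead of it.\<close>
lemma card_robots_at_le_2:
  assumes inv: "\<And>r. r < k \<Longrightarrow> robot_inv i r" and tie: "tie i"
  shows "card (robots_at i v) \<le> 2"
proof (rule ccontr)
  assume "\<not> ?thesis"
  then have "3 \<le> card (robots_at i v)" by simp
  then obtain S where S: "S \<subseteq> robots_at i v" "card S = 3"
    using obtain_subset_with_card_n[of 3 "robots_at i v"] by blast
  then have fin: "finite S" by (intro card_ge_0_finite) simp
  have anti: "cfg i antigoal \<le> 1" using card_antigoal_le_1[OF inv] by (simp add: cfg_eq)
  have v_anti: "v \<noteq> antigoal"
    using card_antigoal_le_1[OF inv] \<open>3 \<le> card (robots_at i v)\<close> by auto
  \<comment> \<open>In a tie the goal shows the same count as the antigoal, hence at most 1.\<close>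
  have v_goal: "v \<noteq> goal"
    using anti tie \<open>3 \<le> card (robots_at i v)\<close> by (auto simp: cfg_eq)
  have at: "r < k" "P i r = v" if "r \<in> S" for r using S(1) that by blast+
  have start: "pos0 r \<noteq> antigoal" "rank v \<le> rank (pos0 r)" "(snd v \<le> c) = (snd (pos0 r) \<le> c)"
    "front r \<or> pos0 r = v" if "r \<in> S" for r
  proof -
    note r = inv[OF at(1)[OF that], unfolded robot_inv_def reachable_def at(2)[OF that]]
    show "rank v \<le> rank (pos0 r)" "(snd v \<le> c) = (snd (pos0 r) \<le> c)"
      using r v_goal by blast+
    show "pos0 r \<noteq> antigoal" "front r \<or> pos0 r = v"
      using r tie v_anti by metis+
  qed
  obtain d where d: "d \<in> S" "\<And>r. r \<in> S \<Longrightarrow> rank (pos0 r) \<le> rank (pos0 d)"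
  proof -
    have "S \<noteq> {}" using S(2) by auto
    then have "Max ((rank \<circ> pos0) ` S) \<in> (rank \<circ> pos0) ` S" using fin by (intro Max_in) auto
    then obtain d where "d \<in> S" "rank (pos0 d) = Max ((rank \<circ> pos0) ` S)" by auto
    then show ?thesis using that[of d] fin by (auto intro: Max_ge)
  qed
  have less: "rank (pos0 r) < rank (pos0 d)" if "r \<in> S" "r \<noteq> d" for r
  proof -
    have "pos0 r \<noteq> pos0 d" using that inj_onD[OF inj_pos0, of r d] at(1)[OF d(1)] at(1)[OF that(1)] by auto
    then have "rank (pos0 r) \<noteq> rank (pos0 d)"
      using rank_inj[OF pos0_in pos0_in, OF at(1) at(1), OF that(1) d(1)]
        start(3)[OF that(1)] start(3)[OF d(1)] by blast
    then show ?thesis using d(2)[OF that(1)] by linarith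
  qed
  have "card (S - {d}) = 2" using S(2) d(1) fin by simp
  then have "S - {d} \<noteq> {}" by (metis card.empty zero_neq_numeral)
  then obtain a where a: "a \<in> S" "a \<noteq> d" by blast
  \<comment> \<open>\<open>a\<close> started strictly nearer than \<open>d\<close> but no nearer
    than \<open>v\<close>, so \<open>d\<close> did not start on \<open>v\<close> and has
    moved.\<close>
  have "front d"
    using start(4)[OF d(1)] start(2)[OF a(1)] less[OF a] by auto
  have "2 \<le> card {s. s < k \<and> pos0 s \<noteq> antigoal \<and> rank (pos0 s) < rank (pos0 d)}"
    unfolding \<open>card (S - {d}) = 2\<close>[symmetric] using at start less by (intro card_mono) auto
  then show False using \<open>front d\<close> unfolding front_def by simp
qed

text \<open>In a tie no count exceeds the cap, so the reading is a sum over robots, and a move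
  changes just one summand.\<close>

lemma weight_cfg:
  assumes inv: "\<And>r. r < k \<Longrightarrow> robot_inv i r" and tie: "tie i"
  shows "weight \<tau> (cfg i) = (\<Sum>r<k. 2 ^ key (\<tau> (P i r)))"
proof -
  have "weight \<tau> (cfg i) = (\<Sum>v\<in>V. card (robots_at i v) * 2 ^ key (\<tau> v))"
    unfolding weight_def cfg_eq using card_robots_at_le_2[OF assms] by (simp add: min_absorb2)
  also have "\<dots> = (\<Sum>r<k. 2 ^ key (\<tau> (P i r)))"
    by (rule sum_robots) (rule robot_invD(2)[OF inv])
  finally show ?thesis .
qed

section \<open>Preservation of the invariant and of the orientation\<close>

lemma invariant_look:
  assumes inv: "\<And>r. r < k \<Longrightarrow> robot_inv i r" and ori: "oriented (cfg i)"
    and none: "D i (sched i) = None" and r: "r < k"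
  shows "robot_inv (Suc i) r"
proof -
  let ?q = "sched i"
  obtain d where P: "P (Suc i) = P i" and D: "D (Suc i) = (D i)(?q := Some d)"
    and "look_result m n k algo (P i) (P i ?q) d"
    using exec_look[OF none] by blast
  then have d: "d = step (cfg i) (P i ?q)" using look_result_oriented ori by blast
  have "robot_inv i ?q" by (rule inv[OF sched_less])
  \<comment> \<open>This robot has not moved, while the two that started ahead of it have not fallen
    back and are not on the antigoal. It therefore sees at least two robots ahead and plans no
    move.\<close>
  have "d = P i ?q" if t: "tie i" "\<not> front ?q" "pos0 ?q \<noteq> antigoal"
  proof -
    let ?S = "{s. s < k \<and> pos0 s \<noteq> antigoal \<and> rank (pos0 s) < rank (pos0 ?q)}"
    have "\<not> (\<forall>a\<in>?S. \<forall>b\<in>?S. a = b)"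
      using t(2) card_le_Suc0_iff_eq[of ?S] unfolding front_def by auto
    then obtain a b where ab: "a \<in> ?S" "b \<in> ?S" "a \<noteq> b" by blast
    have q: "P i ?q = pos0 ?q" using robot_invD(5)[OF inv[OF sched_less]] t by blast
    have *: "s < k" "P i s \<in> V" "P i s \<noteq> antigoal \<and> rank (P i s) < rank (P i ?q)" if "s \<in> ?S" for s
    proof -
      show s: "s < k" using that by blast
      show "P i s \<in> V" by (rule robot_invD(2)[OF inv[OF s]])
      show "P i s \<noteq> antigoal \<and> rank (P i s) < rank (P i ?q)"
        using that q robot_invD(7,8)[OF inv[OF s]] by auto
    qed
    have "2 \<le> (\<Sum>v | v \<in> V \<and> v \<noteq> antigoal \<and> rank v < rank (P i ?q). cfg i v)"
      by (rule cfg_sum_ge_2[of a b]) (use ab * in blast)+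
    then have "\<not> mover (cfg i) (P i ?q)" using t q unfolding mover_def by auto
    then show ?thesis using d by (simp add: step_def)
  qed
  moreover have "d = P i ?q \<or> d = parent (P i ?q)" using d by (simp add: step_def)
  ultimately have "robot_inv (Suc i) ?q"
    using robot_invD[OF \<open>robot_inv i ?q\<close>] unfolding robot_inv_def P D fun_upd_same by blast
  then show ?thesis
    using robot_inv_unmoved[OF inv[OF r], of "Suc i"] P D by (cases "r = ?q") simp_all
qed

text \<open>However old its snapshot, a nontrivial pending move leads to \<open>parent\<close>.
  Hence the counts at the two ends change only in favour of the goal, and as long as the tie lasts
  the readings do so too.\<close>

lemma invariant_step:
  assumes inv: "\<And>r. r < k \<Longrightarrow> robot_inv i r" and ori: "oriented (cfg i)"
  shows "(\<forall>r<k. robot_inv (Suc i) r) \<and> oriented (cfg (Suc i))"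
proof (cases "D i (sched i)")
  case None
  then have "P (Suc i) = P i" using exec_look by blast
  then show ?thesis using invariant_look[OF assms None] ori by simp
next
  case (Some w)
  let ?q = "sched i" and ?u = "P i (sched i)"
  note P = exec_move(1)[OF Some] and D = exec_move(2)[OF Some]
  have q: "?q < k" and u: "?u \<in> V" using sched_less robot_invD(2)[OF inv[OF sched_less]] .
  have w: "w = ?u \<or> w = parent ?u" using robot_invD(3)[OF inv[OF q]] Some by auto
  show ?thesis
  proof (cases "w = ?u")
    case True
    then have P': "P (Suc i) = P i" using P by simp
    have "robot_inv (Suc i) r" if "r < k" for r
      by (rule robot_inv_unmoved[OF inv[OF that]]) (simp_all add: P' D)
    then show ?thesis using ori P' by simp
  next
    case False
    then have w: "w = parent ?u" and u_goal: "?u \<noteq> goal" using w by auto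
    have "robots_at i goal \<subseteq> robots_at (Suc i) goal" using u_goal by (auto simp: P)
    then have "card (robots_at i goal) \<le> card (robots_at (Suc i) goal)" by (intro card_mono) auto
    then have goal_mono: "cfg i goal \<le> cfg (Suc i) goal"
      unfolding cfg_eq by linarith
    have anti_sub: "robots_at (Suc i) antigoal \<subseteq> robots_at i antigoal - {?q}"
      using parent_ne_antigoal[OF u] by (auto simp: P w)
    then have "card (robots_at (Suc i) antigoal) \<le> card (robots_at i antigoal)" by (intro card_mono) auto
    then have anti_mono: "cfg (Suc i) antigoal \<le> cfg i antigoal" unfolding cfg_eq by linarith
    have le: "cfg i antigoal \<le> cfg i goal" using ori unfolding oriented_def by linarith
    show ?thesis
    proof (cases "tie (Suc i)")
      case False
      then have "oriented (cfg (Suc i))" using le goal_mono anti_mono unfolding oriented_def by linarith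
      moreover have "robot_inv (Suc i) r" if "r < k" for r
        using robot_inv_unmoved[OF inv[OF that], of "Suc i"] robot_inv_moved[OF inv[OF q], of "Suc i"]
          False by (cases "r = ?q") (simp_all add: P D w)
      ultimately show ?thesis by blast
    next
      case tie': True
      then have tie: "tie i" using le goal_mono anti_mono by linarith
      \<comment> \<open>Leaving the antigoal would lower its count from 1 to 0 while the goal count
        does not fall, which contradicts the tie after the move.\<close>
      have u_anti: "?u \<noteq> antigoal"
      proof
        assume a: "?u = antigoal"
        then have "?q \<in> robots_at i antigoal" using q by blast
        then have "robots_at i antigoal = {?q}"
          using card_antigoal_le_1[OF inv] card_le_Suc0_iff_eq[of "robots_at i antigoal"] by auto
        then have one: "card (robots_at i antigoal) = 1" and none: "robots_at (Suc i) antigoal = {}"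
          using anti_sub by auto
        have "cfg i antigoal = 1" "cfg (Suc i) antigoal = 0" unfolding cfg_eq one none by simp_all
        then show False using tie tie' goal_mono by linarith
      qed
      have "front ?q"
        using robot_invD(4,6)[OF inv[OF q] tie] u_anti Some False by auto
      have "pos0 ?q \<noteq> antigoal" using robot_invD(4)[OF inv[OF q] tie] u_anti by blast
      then have inv': "robot_inv (Suc i) r" if "r < k" for r
        using robot_inv_unmoved[OF inv[OF that], of "Suc i"] robot_inv_moved[OF inv[OF q], of "Suc i"]
          tie \<open>front ?q\<close> that by (cases "r = ?q") (simp_all add: P D w)
      \<comment> \<open>Stated additively to avoid subtraction on \<open>nat\<close>; the counts are
        exact before and after the move because both times there is a tie.\<close>
      have gain: "weight \<tau> (cfg (Suc i)) + 2 ^ key (\<tau> ?u) = weight \<tau> (cfg i) + 2 ^ key (\<tau> (parent ?u))" for \<tau>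
      proof -
        have "(\<Sum>r<k. (2::nat) ^ key (\<tau> (P (Suc i) r))) = 2 ^ key (\<tau> (parent ?u)) + (\<Sum>r\<in>{..<k} - {?q}. 2 ^ key (\<tau> (P i r)))"
          using q by (subst sum.remove[of _ ?q]) (auto simp: P w intro!: sum.cong)
        moreover have "(\<Sum>r<k. (2::nat) ^ key (\<tau> (P i r))) = 2 ^ key (\<tau> ?u) + (\<Sum>r\<in>{..<k} - {?q}. 2 ^ key (\<tau> (P i r)))"
          using q by (subst sum.remove[of _ ?q]) auto
        ultimately show ?thesis
          using weight_cfg[where i = "Suc i" and \<tau> = \<tau>, OF inv' tie']
            weight_cfg[where i = i and \<tau> = \<tau>, OF inv tie] by linarith
      qed
      have "max (weight fx (cfg i)) (weight (fx \<circ> fy) (cfg i)) < max (weight id (cfg i)) (weight fy (cfg i))"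
        using ori tie unfolding oriented_def by auto
      \<comment> \<open>Each reading from the goal side gains at least as much as each opposite one,
        so strictness survives whichever readings attain the maxima.\<close>
      then have "max (weight fx (cfg (Suc i))) (weight (fx \<circ> fy) (cfg (Suc i)))
          < max (weight id (cfg (Suc i))) (weight fy (cfg (Suc i)))"
        using gain[of id] gain[of fy] gain[of fx] gain[of "fx \<circ> fy"]
          key_gain[OF u u_goal, of id fx] key_gain[OF u u_goal, of id "fx \<circ> fy"]
          key_gain[OF u u_goal, of fy fx] key_gain[OF u u_goal, of fy "fx \<circ> fy"]
        unfolding max_def by (simp del: comp_apply split: if_splits)
      then show ?thesis using inv' tie' unfolding oriented_def by blast
    qed
  qed
qed

lemma invariant: "(\<forall>r<k. robot_inv i r) \<and> oriented (cfg i)"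
proof (induction i)
  case 0
  show ?case using oriented_pos0 pos0_in by (auto simp: robot_inv_def reachable_def init simp del: mem_grid_V)
next
  case (Suc i)
  then show ?case using invariant_step by blast
qed

lemma robot_inv: "r < k \<Longrightarrow> robot_inv i r" and oriented_cfg: "oriented (cfg i)"
  using invariant by blast+

lemma P_in: "r < k \<Longrightarrow> P i r \<in> V"
  using robot_invD(2)[OF robot_inv] .

section \<open>Termination and stable configurations\<close>

lemma rank_sum_decreases:
  "P (Suc i) = P i \<or> (\<Sum>r<k. rank (P (Suc i) r)) < (\<Sum>r<k. rank (P i r))"
proof (cases "D i (sched i)")
  case None
  then show ?thesis using exec_look by blast
next
  case (Some w)
  let ?q = "sched i"
  have w: "w = P i ?q \<or> w = parent (P i ?q)"
    using robot_invD(3)[OF robot_inv[OF sched_less[of i], of i]] Some by auto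
  show ?thesis
  proof (cases "w = P i ?q")
    case True
    then show ?thesis using exec_move(1)[OF Some] by simp
  next
    case False
    then have "rank w < rank (P i ?q)" using w rank_parent_less[OF P_in[OF sched_less[of i], of i]] parent_goal by metis
    then have "(\<Sum>r<k. rank (P (Suc i) r)) < (\<Sum>r<k. rank (P i r))"
      unfolding exec_move(1)[OF Some] using sched_less by (intro sum_strict_mono_ex1) auto
    then show ?thesis ..
  qed
qed

text \<open>\<open>T\<close> minimises the rank sum; any later change of position would lower it
  further.\<close>

lemma eventually_constant: "\<exists>T. \<forall>i\<ge>T. P i = P T"
proof -
  obtain T where T: "\<And>i. (\<Sum>r<k. rank (P T r)) \<le> (\<Sum>r<k. rank (P i r))"
    using ex_has_least_nat[of "\<lambda>_. True" 0 "\<lambda>i. \<Sum>r<k. rank (P i r)"] by auto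
  have "P i = P T" if "i \<ge> T" for i
    using that
  proof (induction i rule: dec_induct)
    case (step i)
    then show ?case using rank_sum_decreases[of i] T[of "Suc i"] by auto
  qed simp
  then show ?thesis by blast
qed

text \<open>The first activation from \<open>t\<close> on is chosen, because only its own
  activations alter the pending move of a robot.\<close>

lemma next_activation:
  assumes "r < k" "crash \<noteq> Some r"
  obtains i where "t \<le> i" "sched i = r" "D i r = D t r"
proof -
  define i where "i = (LEAST i. t \<le> i \<and> sched i = r)"
  have "\<exists>i. t \<le> i \<and> sched i = r" using admissible assms unfolding admissible_def by blast
  then have i: "t \<le> i \<and> sched i = r" unfolding i_def by (rule LeastI_ex)
  have "D j r = D t r" if "t \<le> j" "j \<le> i" for j
    using that
  proof (induction j rule: dec_induct)
    case (step j)
    then have "sched j \<noteq> r" using not_less_Least[of j "\<lambda>i. t \<le> i \<and> sched i = r"] unfolding i_def by auto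
    then have "D (Suc j) r = D j r"
      using exec_look[of j] exec_move(2)[of j] by (cases "D j (sched j)") auto
    then show ?case using step by simp
  qed simp
  then show ?thesis using that i by blast
qed

text \<open>Up to three activations are needed: to discharge an outdated move, to look at the stable
  configuration, and to carry out the result, which must not change the position.\<close>

lemma step_fixed_if_constant:
  assumes T: "\<And>i. T \<le> i \<Longrightarrow> P i = P T" and r: "r < k" "crash \<noteq> Some r"
  shows "step (cfg T) (P T r) = P T r"
proof -
  obtain i where i: "T \<le> i" "sched i = r" "D i r = None"
  proof -
    obtain a where a: "T \<le> a" "sched a = r" using next_activation[OF r] by metis
    show ?thesis
    proof (cases "D a r")
      case None
      then show ?thesis using that a by blast
    next
      case (Some w)
      then have D: "D (Suc a) r = None" using exec_move(2)[of a w] a by simp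
      obtain b where "Suc a \<le> b" "sched b = r" "D b r = D (Suc a) r" using next_activation[OF r] by metis
      then show ?thesis using that[of b] D a by simp
    qed
  qed
  then obtain d where d: "D (Suc i) r = Some d" "look_result m n k algo (P i) (P i r) d"
    using exec_look[of i] by auto
  obtain j where j: "Suc i \<le> j" "sched j = r" "D j r = D (Suc i) r" using next_activation[OF r] by metis
  have "d = step (cfg T) (P T r)"
    using look_result_oriented[OF d(2) oriented_cfg] T[OF i(1)] by simp
  moreover have "P (Suc j) r = d" using exec_move(1)[of j d] j d by simp
  ultimately show ?thesis using T[of "Suc j"] i j by simp
qed

lemma step_moves: "mover g v \<Longrightarrow> v \<noteq> goal \<Longrightarrow> step g v \<noteq> v"
  by (simp add: step_def parent_eq_self)

lemma mover_if_one_ahead: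
  assumes "{s. s < k \<and> P i s \<noteq> antigoal \<and> rank (P i s) < rank (P i r)} \<subseteq> {a}"
  shows "mover (cfg i) (P i r)"
proof -
  have "card {s. s < k \<and> P i s \<noteq> antigoal \<and> rank (P i s) < rank (P i r)} \<le> 1"
    using card_mono[OF _ assms] by simp
  moreover have "(\<Sum>v | v \<in> V \<and> v \<noteq> antigoal \<and> rank v < rank (P i r). cfg i v) \<le>
      card {s. s < k \<and> P i s \<noteq> antigoal \<and> rank (P i s) < rank (P i r)}"
    by (rule cfg_sum_le) (rule P_in)
  ultimately show ?thesis unfolding mover_def by linarith
qed

text \<open>If the antigoal is empty, so is the goal, and two robots of least rank may move.
  Otherwise each end holds exactly one robot; the one on the antigoal may move, and so may a nearest
  robot on neither end, which exists because \<open>k \<ge> 3\<close>.\<close>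

lemma two_movers:
  assumes tie: "tie i"
  obtains a b where "a < k" "b < k" "a \<noteq> b"
    "step (cfg i) (P i a) \<noteq> P i a" "step (cfg i) (P i b) \<noteq> P i b"
proof (cases "robots_at i antigoal = {}")
  case True
  then have "card (robots_at i antigoal) = 0" by (simp only: card.empty)
  then have "card (robots_at i goal) = 0" using tie unfolding cfg_eq by linarith
  then have goal: "P i r \<noteq> goal" if "r < k" for r using that by auto
  obtain a where a: "a < k" "\<And>s. s < k \<Longrightarrow> rank (P i a) \<le> rank (P i s)"
    using ex_has_least_nat[of "\<lambda>r. r < k" 0 "\<lambda>r. rank (P i r)"] k_ge by auto
  have "\<exists>b. b < k \<and> b \<noteq> a" using k_ge by (intro exI[of _ "if a = 0 then 1 else 0"]) auto
  then obtain b where b: "b < k" "b \<noteq> a" "\<And>s. s < k \<Longrightarrow> s \<noteq> a \<Longrightarrow> rank (P i b) \<le> rank (P i s)"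
    using ex_has_least_nat[of "\<lambda>r. r < k \<and> r \<noteq> a" _ "\<lambda>r. rank (P i r)"] by blast
  have "mover (cfg i) (P i a)" "mover (cfg i) (P i b)"
    using a(2) b(3) by (intro mover_if_one_ahead[of _ _ a]; force)+
  then show ?thesis using that[of a b] a b goal step_moves by metis
next
  case False
  then obtain z where z: "z < k" "P i z = antigoal" by blast
  have "card (robots_at i antigoal) \<noteq> 0" using False by simp
  then have "card (robots_at i goal) = 1"
    using card_antigoal_le_1[OF robot_inv, of i] tie unfolding cfg_eq by linarith
  then obtain g where g: "robots_at i goal = {g}" by (auto simp: card_1_singleton_iff)
  have "card ({..<k} - {z, g}) \<noteq> 0"
    using k_ge diff_card_le_card_Diff[of "{z, g}" "{..<k}"] card_insert_le_m1[of 2 "{g}" z]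
    by (simp del: card_0_eq)
  then have "\<exists>b. b < k \<and> b \<noteq> z \<and> b \<noteq> g" by (metis DiffE card.empty equals0I insertCI lessThan_iff)
  then obtain b where b: "b < k" "b \<noteq> z" "b \<noteq> g"
    "\<And>s. s < k \<Longrightarrow> s \<noteq> z \<Longrightarrow> s \<noteq> g \<Longrightarrow> rank (P i b) \<le> rank (P i s)"
    using ex_has_least_nat[of "\<lambda>r. r < k \<and> r \<noteq> z \<and> r \<noteq> g" _ "\<lambda>r. rank (P i r)"] by blast
  have "mover (cfg i) (P i b)"
  proof (rule mover_if_one_ahead[of _ _ g])
    show "{s. s < k \<and> P i s \<noteq> antigoal \<and> rank (P i s) < rank (P i b)} \<subseteq> {g}"
      using b(4) z(2) by (force simp: not_less[symmetric])
  qed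
  moreover have "P i b \<noteq> goal" using b g by blast
  moreover have "mover (cfg i) (P i z)" using z(2) by (simp add: mover_def)
  ultimately show ?thesis using that[of b z] b z goal_ne_antigoal step_moves by metis
qed

lemma gathered: "gathered k crash P"
proof -
  obtain T where T: "\<And>i. T \<le> i \<Longrightarrow> P i = P T" using eventually_constant by blast
  have fixed: "step (cfg T) (P T r) = P T r" if "r < k" "crash \<noteq> Some r" for r
    using step_fixed_if_constant[of T r] T that by blast
  have "\<not> tie T"
  proof
    assume "tie T"
    \<comment> \<open>At most one of the two movers has crashed, and the other one is fixed by
      \<open>step\<close>.\<close>
    then show False by (rule two_movers) (metis fixed option.inject)
  qed
  then have "cfg T antigoal < cfg T goal" using oriented_cfg[of T] unfolding oriented_def by simp
  \<comment> \<open>Without a tie every robot is a mover, and \<open>parent\<close> fixes only the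
    goal.\<close>
  then have "P T r = goal" if "r < k" "crash \<noteq> Some r" for r
    using fixed[OF that] by (simp add: step_def mover_def parent_eq_self)
  then show ?thesis unfolding gathered_def using T by metis
qed

end

section \<open>Gatherability\<close>

lemma gatherable_if_oriented:
  assumes "even_odd_grid m n c" "3 \<le> k" "inj_on pos0 {..<k}" "pos0 ` {..<k} \<subseteq> grid_V m n"
    and "even_odd_grid.oriented m n c (config_of k pos0)"
  shows "gatherable_1crash m n k pos0"
proof -
  interpret even_odd_grid m n c by (rule assms)
  have "gathered k crash P" if "admissible k sched crash" "execution m n k algo pos0 sched P D"
    for sched crash P D
  proof -
    interpret crash_execution m n c k pos0 sched crash P D
      using assms that by unfold_locales auto
    show ?thesis by (rule gathered)
  qed
  then show ?thesis unfolding gatherable_1crash_def using valid_algo by blast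
qed

text \<open>One of the two ends is selected. If it is the antigoal, the start is reflected by
  \<open>fx\<close> and the result is transferred back.\<close>

lemma gatherable_if_not_flip_symmetric:
  fixes pos0 :: "nat \<Rightarrow> node"
  assumes grid: "even m" "odd n" and k: "3 \<le> k" and inj: "inj_on pos0 {..<k}"
    and V: "pos0 ` {..<k} \<subseteq> grid_V m n"
    and not_x: "\<not> (\<forall>v\<in>grid_V m n. config_of k pos0 (flip_x m v) = config_of k pos0 v)"
    and not_xy: "\<not> (\<forall>v\<in>grid_V m n. config_of k pos0 (flip_x m (flip_y n v)) = config_of k pos0 v)"
  shows "gatherable_1crash m n k pos0"
proof -
  obtain c where n: "n = 2 * c + 1" using grid(2) by (auto elim: oddE)
  have "pos0 0 \<in> grid_V m n" using subsetD[OF V, of "pos0 0"] k by simp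
  then interpret even_odd_grid m n c using grid n by unfold_locales auto
  have le1: "config_of k pos0 v \<le> 1" for v
  proof -
    have "card {r. r < k \<and> pos0 r = v} \<le> Suc 0"
      using inj by (subst card_le_Suc0_iff_eq) (auto dest: inj_onD)
    then show ?thesis by (simp add: config_of_def)
  qed
  have "oriented (config_of k pos0) \<or> oriented (config_of k pos0 \<circ> fx)"
    using oriented_total[of "config_of k pos0", OF le1] not_x not_xy by blast
  then show ?thesis
  proof
    assume "oriented (config_of k pos0)"
    then show ?thesis using gatherable_if_oriented even_odd_grid_axioms k inj V by blast
  next
    assume ori: "oriented (config_of k pos0 \<circ> fx)"
    have fxV: "pos0 r \<in> V" if "r < k" for r using V that by blast
    have "config_of k (fx \<circ> pos0) v = (config_of k pos0 \<circ> fx) v" if "v \<in> V" for v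
    proof -
      have "{r. r < k \<and> (fx \<circ> pos0) r = v} = {r. r < k \<and> pos0 r = fx v}"
        using fx_fx[OF fxV] fx_fx[OF that] by (auto simp del: mem_grid_V)
      then show ?thesis by (simp add: config_of_def)
    qed
    then have "oriented (config_of k (fx \<circ> pos0))"
      using ori oriented_cong[of "config_of k (fx \<circ> pos0)" "config_of k pos0 \<circ> fx"] by blast
    moreover have "inj_on (fx \<circ> pos0) {..<k}"
    proof (rule comp_inj_on[OF inj], rule inj_on_inverseI)
      fix v assume "v \<in> pos0 ` {..<k}"
      then show "fx (fx v) = v" using V by (intro fx_fx) blast
    qed
    moreover have "(fx \<circ> pos0) ` {..<k} \<subseteq> V"
      unfolding image_comp[symmetric] using V fx_in by blast
    ultimately have "gatherable_1crash m n k (fx \<circ> pos0)"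
      using gatherable_if_oriented even_odd_grid_axioms k by blast
    then show ?thesis
    proof (rule gatherable_1crash_iso[where \<psi>' = fx, OF _ V])
      fix u v assume uv: "u \<in> V" "v \<in> V"
      show "grid_adj (fx u) (fx v) \<longleftrightarrow> grid_adj u v"
        unfolding grid_adj_iff_dist grid_dist_flip_x[OF uv] ..
    qed (rule fx_in fx_fx, assumption)+
  qed
qed

theorem theorem3:
  fixes m n k :: nat and pos0 :: "nat \<Rightarrow> node"
  assumes "(even m \<and> odd n) \<or> (odd m \<and> even n)"
    and "k \<ge> 3"
    and "inj_on pos0 {..<k}"
    and "pos0 ` {..<k} \<subseteq> grid_V m n"
    and "\<not> partitive m n (config_of k pos0)"
  shows "gatherable_1crash m n k pos0"
proof -
  let ?f = "config_of k pos0"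
  have ne: "pos0 0 \<in> grid_V m n" using subsetD[OF assms(4), of "pos0 0"] assms(2) by simp
  show ?thesis
    using assms(1)
  proof
    assume grid: "even m \<and> odd n"
    then obtain c where "n = 2 * c + 1" by (auto elim: oddE)
    then interpret even_odd_grid m n c using grid ne by unfold_locales auto
    show ?thesis
    proof (rule gatherable_if_not_flip_symmetric)
      \<comment> \<open>For even \<open>m\<close> both reflections are free involutions, so either
        symmetry would make the configuration partitive.\<close>
      show "\<not> (\<forall>v\<in>grid_V m n. ?f (flip_x m v) = ?f v)"
        using partitive_if_free_involution[OF grid_aut_flip_x fx_fx fx_no_fixpoint _ ne] assms(5) by blast
      show "\<not> (\<forall>v\<in>grid_V m n. ?f (flip_x m (flip_y n v)) = ?f v)"
        using partitive_if_free_involution[OF grid_aut_flip_xy _ fx_fy_no_fixpoint _ ne] assms(5)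
          fx_fx fy_fy fx_fy fx_in fy_in by metis
    qed (use grid assms in auto)
  next
    assume grid: "odd m \<and> even n"
    then obtain c where "m = 2 * c + 1" by (auto elim: oddE)
    then interpret even_odd_grid n m c using grid ne by unfold_locales auto
    have V: "pos0 r \<in> grid_V m n" if "r < k" for r using assms(4) that by blast
    have cfg: "config_of k (prod.swap \<circ> pos0) v = ?f (prod.swap v)" for v
      unfolding config_of_def comp_apply by (metis swap_swap)
    \<comment> \<open>Exchanging the coordinates puts the even side along x; \<open>flip_x\<close>
      of the swapped grid corresponds to \<open>flip_y\<close> of the original.\<close>
    have "gatherable_1crash n m k (prod.swap \<circ> pos0)"
    proof (rule gatherable_if_not_flip_symmetric)
      show "inj_on (prod.swap \<circ> pos0) {..<k}" using assms(3) by (simp add: comp_inj_on)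
      show "(prod.swap \<circ> pos0) ` {..<k} \<subseteq> grid_V n m" using V by auto
      show "\<not> (\<forall>v\<in>grid_V n m. config_of k (prod.swap \<circ> pos0) (flip_x n v) = config_of k (prod.swap \<circ> pos0) v)"
      proof
        assume sym: "\<forall>v\<in>grid_V n m. config_of k (prod.swap \<circ> pos0) (flip_x n v) = config_of k (prod.swap \<circ> pos0) v"
        have "partitive m n ?f"
        proof (rule partitive_if_free_involution[OF grid_aut_flip_y _ _ _ ne])
          fix v assume "v \<in> grid_V m n"
          then have v: "prod.swap v \<in> V" by simp
          have flip: "flip_y n v = prod.swap (fx (prod.swap v))" by (simp add: flip_x_def flip_y_def)
          show "flip_y n (flip_y n v) = v" using fx_fx[OF v] by (simp add: flip_x_def flip_y_def prod_eq_iff)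
          show "flip_y n v \<noteq> v" using fx_no_fixpoint[OF v] flip by (metis swap_swap)
          show "?f (flip_y n v) = ?f v" using bspec[OF sym v] unfolding cfg flip swap_swap .
        qed
        then show False using assms(5) by blast
      qed
      show "\<not> (\<forall>v\<in>grid_V n m. config_of k (prod.swap \<circ> pos0) (flip_x n (flip_y m v)) = config_of k (prod.swap \<circ> pos0) v)"
      proof
        assume sym: "\<forall>v\<in>grid_V n m. config_of k (prod.swap \<circ> pos0) (flip_x n (flip_y m v)) = config_of k (prod.swap \<circ> pos0) v"
        have "partitive m n ?f"
        proof (rule partitive_if_free_involution[OF grid_aut_flip_xy _ _ _ ne])
          fix v assume v': "v \<in> grid_V m n"
          then have v: "prod.swap v \<in> V" by simp
          have flip: "flip_x m (flip_y n v) = prod.swap (fx (fy (prod.swap v)))"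
            by (simp add: flip_x_def flip_y_def)
          show "flip_x m (flip_y n (flip_x m (flip_y n v))) = v"
            using v' by (auto simp: flip_x_def flip_y_def)
          show "flip_x m (flip_y n v) \<noteq> v" using fx_fy_no_fixpoint[OF v] flip by (metis swap_swap)
          show "?f (flip_x m (flip_y n v)) = ?f v" using bspec[OF sym v] unfolding cfg flip swap_swap .
        qed
        then show False using assms(5) by blast
      qed
    qed (use grid assms in auto)
    then show ?thesis
      by (rule gatherable_1crash_iso[where \<psi>' = prod.swap])
        (use assms(4) in \<open>auto simp: grid_adj_def\<close>)
  qed
qed

end
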